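(* Let $K$ be a finite acyclic $2$-dimensional simplicial complex. Then $K$ is collapsible if and only if $\mathfrak{N}(K)=0$, where $\mathfrak{N}(K)=\min\{|\mathfrak{N}(K,f)| : f:K\to\mathbb{R} \text{ an optimal combinatorial Morse function}\}$ and $\mathfrak{N}(K,f)=\sum_{\sigma\in K}(-1)^{\dim(\sigma)}h_f(\sigma)$, with $h_f$ the normalization of $f$.
   Context: Simplicial complexes are finite; the notation $\sigma\in K$ ranges over the non-empty simplices of $K$. Acyclic means that the reduced (integral) homology is trivial in all degrees. A complex is collapsible if it can be reduced to a single vertex by a finite sequence of elementary simplicial collapses (removing a pair $\sigma\prec\tau$ where $\sigma$ is a proper face of no simplex other than $\tau$). Write $\sigma\prec\tau$ if $\sigma$ is an immediate face of $\tau$, i.e. a face of $\tau$ with $\dim\tau=\dim\sigma+1$. A combinatorial (discrete, in the sense of Forman) Morse function over $K$ is a map $f:K\to\mathbb{R}$ such that for every simplex $\sigma\in K$: $\#\{\tau\succ\sigma : f(\tau)\le f(\sigma)\}\le 1$ and $\#\{\nu\prec\sigma : f(\nu)\ge f(\sigma)\}\le 1$. A simplex $\sigma$ is critical for $f$ if both of these numbers are $0$. The gradient field of $f$ is the set of pairs $(\sigma,\tau)$ with $\sigma\prec\tau$ and $f(\sigma)\ge f(\tau)$. Two combinatorial Morse functions over $K$ are equivalent if they induce the same gradient field. An optimal combinatorial Morse function over $K$ is one having the least possible number of critical simplices among all combinatorial Morse functions over $K$. For a combinatorial Morse function $f:K\to\mathbb{R}$, let $\mathcal{Z}_f$ be the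 (non-empty) set of all combinatorial Morse functions $g:K\to\mathbb{Z}_{\ge 0}$ equivalent to $f$. The normalization of $f$ is the map $h_f:K\to\mathbb{Z}_{\ge 0}$ given by $h_f(\sigma)=\min_{g\in\mathcal{Z}_f}g(\sigma)$. *)

theory Defs
  imports Complex_Main "HOL-Algebra.Free_Abelian_Groups"
begin

(* A simplicial complex is represented by the set of its non-empty simplices, each simplex
   being the set of its vertices. *)

definition finite_simplicial_complex :: "'a set set \<Rightarrow> bool" where
  "finite_simplicial_complex K \<longleftrightarrow>
     finite K \<and>
     (\<forall>\<sigma>\<in>K. finite \<sigma> \<and> \<sigma> \<noteq> {}) \<and>
     (\<forall>\<sigma>\<in>K. \<forall>\<rho>. \<rho> \<subseteq> \<sigma> \<and> \<rho> \<noteq> {} \<longrightarrow> \<rho> \<in> K)"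

(* Truncated subtraction: meaningful for non-empty simplices only. *)
definition simplex_dim :: "'a set \<Rightarrow> nat" where
  "simplex_dim \<sigma> = card \<sigma> - 1"

definition has_dimension :: "'a set set \<Rightarrow> nat \<Rightarrow> bool" where
  "has_dimension K n \<longleftrightarrow>
     (\<forall>\<sigma>\<in>K. simplex_dim \<sigma> \<le> n) \<and> (\<exists>\<sigma>\<in>K. simplex_dim \<sigma> = n)"

definition immediate_face :: "'a set \<Rightarrow> 'a set \<Rightarrow> bool" where
  "immediate_face \<sigma> \<tau> \<longleftrightarrow> \<sigma> \<subseteq> \<tau> \<and> card \<tau> = card \<sigma> + 1"

(* Simplicial chains are formed with respect to one arbitrarily chosen total order of the
   vertices; another choice gives isomorphic homology groups. *)
definition vertex_order :: "'a rel" where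
  "vertex_order = (SOME r. linear_order r)"

(* Here the empty simplex is adjoined, in degree -1, so that the chain complex is the
   augmented one; the chain group is trivial in degrees below -1. *)
definition simplicial_chain_group :: "'a set set \<Rightarrow> int \<Rightarrow> ('a set \<Rightarrow>\<^sub>0 int) monoid" where
  "simplicial_chain_group K p =
     free_Abelian_group {\<sigma> \<in> insert {} K. int (card \<sigma>) = p + 1}"

(* On generators, the boundary of [v_0, ..., v_p] is the sum of (-1)^i [v_0, ..., v_p without v_i];
   the index i of a vertex v is the number of vertices of the simplex strictly preceding v. *)
definition simplicial_boundary :: "('a set \<Rightarrow>\<^sub>0 int) \<Rightarrow> ('a set \<Rightarrow>\<^sub>0 int)" where
  "simplicial_boundary =
     frag_extend (\<lambda>\<sigma>. \<Sum>v\<in>\<sigma>.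
       frag_cmul ((-1) ^ card {u \<in> \<sigma>. u \<noteq> v \<and> (u, v) \<in> vertex_order}) (frag_of (\<sigma> - {v})))"

definition simplicial_cycles :: "'a set set \<Rightarrow> int \<Rightarrow> ('a set \<Rightarrow>\<^sub>0 int) set" where
  "simplicial_cycles K p =
     kernel (simplicial_chain_group K p) (simplicial_chain_group K (p - 1)) simplicial_boundary"

definition simplicial_boundaries :: "'a set set \<Rightarrow> int \<Rightarrow> ('a set \<Rightarrow>\<^sub>0 int) set" where
  "simplicial_boundaries K p =
     simplicial_boundary ` carrier (simplicial_chain_group K (p + 1))"

definition reduced_simplicial_homology_group ::
    "'a set set \<Rightarrow> int \<Rightarrow> ('a set \<Rightarrow>\<^sub>0 int) set monoid" where
  "reduced_simplicial_homology_group K p =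
     subgroup_generated (simplicial_chain_group K p) (simplicial_cycles K p)
       Mod simplicial_boundaries K p"

definition acyclic_complex :: "'a set set \<Rightarrow> bool" where
  "acyclic_complex K \<longleftrightarrow> (\<forall>p. trivial_group (reduced_simplicial_homology_group K p))"

definition elementary_collapse :: "'a set set \<Rightarrow> 'a set set \<Rightarrow> bool" where
  "elementary_collapse K L \<longleftrightarrow>
     (\<exists>\<sigma>\<in>K. \<exists>\<tau>\<in>K. immediate_face \<sigma> \<tau> \<and> (\<forall>\<rho>\<in>K. \<sigma> \<subset> \<rho> \<longrightarrow> \<rho> = \<tau>) \<and> L = K - {\<sigma>, \<tau>})"

definition collapsible :: "'a set set \<Rightarrow> bool" where
  "collapsible K \<longleftrightarrow> (\<exists>v. elementary_collapse\<^sup>*\<^sup>* K {{v}})"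

(* Functions on a complex are total functions on sets of vertices; every notion below depends
   only on their values on the simplices of the complex. *)

definition upward_exceptions :: "'a set set \<Rightarrow> ('a set \<Rightarrow> real) \<Rightarrow> 'a set \<Rightarrow> 'a set set" where
  "upward_exceptions K f \<sigma> = {\<tau> \<in> K. immediate_face \<sigma> \<tau> \<and> f \<tau> \<le> f \<sigma>}"

definition downward_exceptions :: "'a set set \<Rightarrow> ('a set \<Rightarrow> real) \<Rightarrow> 'a set \<Rightarrow> 'a set set" where
  "downward_exceptions K f \<sigma> = {\<nu> \<in> K. immediate_face \<nu> \<sigma> \<and> f \<nu> \<ge> f \<sigma>}"

definition morse_function :: "'a set set \<Rightarrow> ('a set \<Rightarrow> real) \<Rightarrow> bool" where
  "morse_function K f \<longleftrightarrow>
     (\<forall>\<sigma>\<in>K. card (upward_exceptions K f \<sigma>) \<le> 1 \<and> card (downward_exceptions K f \<sigma>) \<le> 1)"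

definition critical_simplices :: "'a set set \<Rightarrow> ('a set \<Rightarrow> real) \<Rightarrow> 'a set set" where
  "critical_simplices K f =
     {\<sigma> \<in> K. card (upward_exceptions K f \<sigma>) = 0 \<and> card (downward_exceptions K f \<sigma>) = 0}"

definition gradient_field :: "'a set set \<Rightarrow> ('a set \<Rightarrow> real) \<Rightarrow> ('a set \<times> 'a set) set" where
  "gradient_field K f = {(\<sigma>, \<tau>). \<sigma> \<in> K \<and> \<tau> \<in> K \<and> immediate_face \<sigma> \<tau> \<and> f \<sigma> \<ge> f \<tau>}"

definition equivalent_morse :: "'a set set \<Rightarrow> ('a set \<Rightarrow> real) \<Rightarrow> ('a set \<Rightarrow> real) \<Rightarrow> bool" where
  "equivalent_morse K f g \<longleftrightarrow>
     morse_function K f \<and> morse_function K g \<and> gradient_field K f = gradient_field K g"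

definition optimal_morse_function :: "'a set set \<Rightarrow> ('a set \<Rightarrow> real) \<Rightarrow> bool" where
  "optimal_morse_function K f \<longleftrightarrow>
     morse_function K f \<and>
     (\<forall>g. morse_function K g \<longrightarrow>
        card (critical_simplices K f) \<le> card (critical_simplices K g))"

definition nat_equivalents :: "'a set set \<Rightarrow> ('a set \<Rightarrow> real) \<Rightarrow> ('a set \<Rightarrow> nat) set" where
  "nat_equivalents K f = {g. equivalent_morse K f (\<lambda>\<sigma>. real (g \<sigma>))}"

definition normalization :: "'a set set \<Rightarrow> ('a set \<Rightarrow> real) \<Rightarrow> 'a set \<Rightarrow> nat" where
  "normalization K f \<sigma> = (LEAST n. \<exists>g \<in> nat_equivalents K f. n = g \<sigma>)"

definition morse_number :: "'a set set \<Rightarrow> ('a set \<Rightarrow> real) \<Rightarrow> int" where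
  "morse_number K f = (\<Sum>\<sigma>\<in>K. (-1) ^ simplex_dim \<sigma> * int (normalization K f \<sigma>))"

definition min_morse_number :: "'a set set \<Rightarrow> nat" where
  "min_morse_number K =
     (LEAST n. \<exists>f. optimal_morse_function K f \<and> n = nat \<bar>morse_number K f\<bar>)"

end

(* Let h be the normalization of a Morse function f. In dimension 2 minimality forces h to take the
   same value on both members of a gradient pair, so every sublevel set of h is a subcomplex and the
   Morse number is the alternating sum of h over the critical simplices. Critical vertices have h = 0,
   so a collapsible complex, which has a Morse function with a single critical simplex, has number 0.

   Conversely let f be optimal. Then it has one critical vertex, since otherwise the vertices could be
   rematched along a spanning tree of the edges that are not paired with triangles. Acyclicity now gives
   as many critical triangles as critical edges. Moreover, as the second homology of K vanishes, the
   boundary embeds the triangles of {h <= n} into the cycles of the subcomplex of {h <= n} without the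
   critical edges at level n, whence {h <= n} has at most as many critical triangles as {h < n} has
   critical edges. So, in increasing order, the i-th critical triangle lies strictly above the i-th
   critical edge, and the Morse number is at least the number of critical edges. If it vanishes, only
   the critical vertex is left, and removing the gradient pairs from the highest level down collapses K. *)
theory Submission
  imports Defs
begin

subsection \<open>Counting and distances\<close>

text \<open>Gaussian elimination of a homogeneous system with more unknowns than equations, one
  equation per induction step. Cross-multiplying with the pivot replaces division, so the solution
  stays integral.\<close>

lemma integer_kernel_vector:
  fixes M :: "'a \<Rightarrow> 'b \<Rightarrow> int"
  assumes "finite B" "finite A" "card B < card A"
  shows "\<exists>x. (\<exists>a\<in>A. x a \<noteq> 0) \<and> (\<forall>b\<in>B. (\<Sum>a\<in>A. x a * M a b) = 0)"
  using assms
proof (induction B arbitrary: A M rule: finite_induct)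
  case empty
  then have "A \<noteq> {}" by auto
  then show ?case by (intro exI[of _ "\<lambda>_. 1"]) auto
next
  case (insert b B)
  show ?case
  proof (cases "\<forall>a\<in>A. M a b = 0")
    case True
    have "card B < card A" using insert by simp
    from insert.IH[OF \<open>finite A\<close> this, of M] True show ?thesis by auto
  next
    case False
    then obtain a\<^sub>0 where a0: "a\<^sub>0 \<in> A" "M a\<^sub>0 b \<noteq> 0" by blast
    \<comment> \<open>Coefficients after eliminating the unknown \<open>a\<^sub>0\<close> by means
      of equation \<open>b\<close>, whose pivot \<open>M a\<^sub>0 b\<close> is nonzero.\<close>
    let ?M = "\<lambda>a b'. M a\<^sub>0 b * M a b' - M a b * M a\<^sub>0 b'"
    have "card B < card (A - {a\<^sub>0})" using insert a0 by simp
    from insert.IH[OF _ this, of ?M] insert.prems obtain x where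
      x: "\<exists>a\<in>A - {a\<^sub>0}. x a \<noteq> 0" "\<And>b'. b' \<in> B \<Longrightarrow> (\<Sum>a\<in>A - {a\<^sub>0}. x a * ?M a b') = 0"
      by auto
    \<comment> \<open>Back substitution: \<open>s\<close> is the value of the unknown at
      \<open>a\<^sub>0\<close> that solves equation \<open>b\<close> once the other unknowns are
      scaled by the pivot.\<close>
    define s where "s = - (\<Sum>a\<in>A - {a\<^sub>0}. x a * M a b)"
    define y where "y = (\<lambda>a. M a\<^sub>0 b * x a)(a\<^sub>0 := s)"
    have sum_y: "(\<Sum>a\<in>A. y a * M a b') = s * M a\<^sub>0 b' + M a\<^sub>0 b * (\<Sum>a\<in>A - {a\<^sub>0}. x a * M a b')" for b'
    proof -
      have "(\<Sum>a\<in>A. y a * M a b') = y a\<^sub>0 * M a\<^sub>0 b' + (\<Sum>a\<in>A - {a\<^sub>0}. y a * M a b')"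
        using insert.prems a0 by (intro sum.remove) auto
      also have "(\<Sum>a\<in>A - {a\<^sub>0}. y a * M a b') = M a\<^sub>0 b * (\<Sum>a\<in>A - {a\<^sub>0}. x a * M a b')"
        unfolding sum_distrib_left by (rule sum.cong) (auto simp: y_def)
      finally show ?thesis by (simp add: y_def)
    qed
    have "(\<Sum>a\<in>A. y a * M a b') = 0" if "b' \<in> insert b B" for b'
    proof (cases "b' = b")
      case True
      then show ?thesis by (simp add: sum_y s_def)
    next
      case False
      then have "0 = (\<Sum>a\<in>A - {a\<^sub>0}. x a * ?M a b')" using x(2) that by simp
      also have "\<dots> = M a\<^sub>0 b * (\<Sum>a\<in>A - {a\<^sub>0}. x a * M a b') + s * M a\<^sub>0 b'"
        by (simp add: s_def sum_distrib_left sum_distrib_right sum_subtractf algebra_simps)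
      finally show ?thesis by (simp add: sum_y)
    qed
    moreover have "\<exists>a\<in>A. y a \<noteq> 0" using x(1) a0 by (auto simp: y_def)
    ultimately show ?thesis by blast
  qed
qed

text \<open>Layer-cake summation: a sum of naturals counts, over all levels \<open>n\<close>, the
  terms exceeding \<open>n\<close>. In terms of sorted values, the level condition puts the i-th
  smallest \<open>f\<close> strictly above the i-th smallest \<open>g\<close>; the gap of at least
  one per element of \<open>B\<close> is the summand \<open>card B\<close>.\<close>

lemma sum_gap_of_level_counts:
  fixes f :: "'a \<Rightarrow> nat" and g :: "'b \<Rightarrow> nat"
  assumes fin: "finite A" "finite B" and le: "card B \<le> card A"
    and levels: "\<And>n. card {a\<in>A. f a \<le> n} \<le> card {b\<in>B. g b < n}"
  shows "(\<Sum>b\<in>B. g b) + card B \<le> (\<Sum>a\<in>A. f a)"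
proof -
  have layers: "(\<Sum>c\<in>C. k c) = (\<Sum>n<N. card {c\<in>C. n < k c})"
    if "finite C" "\<And>c. c \<in> C \<Longrightarrow> k c \<le> N" for C :: "'c set" and k :: "'c \<Rightarrow> nat" and N
  proof -
    have "(\<Sum>c\<in>C. k c) = (\<Sum>c\<in>C. \<Sum>n<N. if n < k c then 1 else 0)"
    proof (rule sum.cong)
      fix c assume "c \<in> C"
      then have "{n. n < N \<and> n < k c} = {..<k c}" using that(2)[of c] by auto
      then show "k c = (\<Sum>n<N. if n < k c then 1 else 0)"
        by (simp add: sum.If_cases Int_def)
    qed simp
    also have "\<dots> = (\<Sum>n<N. \<Sum>c\<in>C. if n < k c then 1 else 0)"
      by (rule sum.swap)
    also have "\<dots> = (\<Sum>n<N. card {c\<in>C. n < k c})"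
      using that(1) by (simp add: sum.If_cases Int_def)
    finally show ?thesis .
  qed
  have split: "card {c\<in>C. n < k c} = card C - card {c\<in>C. k c \<le> n}"
    if "finite C" for C :: "'c set" and k :: "'c \<Rightarrow> nat" and n
  proof -
    have "{c\<in>C. n < k c} = C - {c\<in>C. k c \<le> n}" by auto
    then show ?thesis using that by (simp add: card_Diff_subset)
  qed
  \<comment> \<open>A common height for the layers of both sums: it bounds every \<open>f a\<close>
    and every \<open>Suc (g b)\<close>.\<close>
  define N where "N = (\<Sum>a\<in>A. f a) + (\<Sum>b\<in>B. Suc (g b))"
  have N: "f a \<le> N" if "a \<in> A" for a
    unfolding N_def using fin that by (metis member_le_sum trans_le_add1 zero_le)
  have N': "Suc (g b) \<le> N" if "b \<in> B" for b
    unfolding N_def using fin that member_le_sum[of b B "\<lambda>b. Suc (g b)"] by auto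
  have "(\<Sum>b\<in>B. g b) + card B = (\<Sum>b\<in>B. Suc (g b))"
    by (simp add: sum_Suc)
  also have "\<dots> = (\<Sum>n<N. card {b\<in>B. n < Suc (g b)})"
    by (intro layers fin N')
  also have "\<dots> = (\<Sum>n<N. card B - card {b\<in>B. Suc (g b) \<le> n})"
    by (intro sum.cong refl split fin)
  \<comment> \<open>Subtraction is monotone in its first and antitone in its second argument;
    \<open>Suc (g b) \<le> n\<close> is the \<open>g b < n\<close> of the level condition.\<close>
  also have "\<dots> \<le> (\<Sum>n<N. card A - card {a\<in>A. f a \<le> n})"
    using le levels by (intro sum_mono diff_le_mono2 diff_le_mono order.trans[OF diff_le_mono[OF le]])
      (simp add: Suc_le_eq)
  also have "\<dots> = (\<Sum>n<N. card {a\<in>A. n < f a})"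
    by (intro sum.cong refl split[symmetric] fin)
  also have "\<dots> = (\<Sum>a\<in>A. f a)"
    by (intro layers[symmetric] fin N)
  finally show ?thesis .
qed

text \<open>Breadth-first search: \<open>d\<close> is the length of a shortest path from
  \<open>r\<close>, and the parent is the last vertex before the end of such a path. Nothing is
  claimed for unreachable vertices, where \<open>LEAST\<close> has no witness.\<close>

lemma rooted_distance:
  obtains d :: "'a \<Rightarrow> nat" and par :: "'a \<Rightarrow> 'a" where
    "\<And>v. (r, v) \<in> R\<^sup>* \<Longrightarrow> v \<noteq> r \<Longrightarrow> (par v, v) \<in> R \<and> d v = Suc (d (par v))"
proof -
  define d where "d v = (LEAST n. (r, v) \<in> R ^^ n)" for v
  have "\<exists>u. (u, v) \<in> R \<and> d v = Suc (d u)" if v: "(r, v) \<in> R\<^sup>*" "v \<noteq> r" for v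
  proof -
    obtain n where "(r, v) \<in> R ^^ n" using v(1) rtrancl_imp_relpow by blast
    then have dv: "(r, v) \<in> R ^^ d v" unfolding d_def by (rule LeastI)
    then obtain m where m: "d v = Suc m" using v(2) by (cases "d v") auto
    then obtain u where u: "(r, u) \<in> R ^^ m" "(u, v) \<in> R" using dv by (auto elim: relpow_Suc_E)
    have "(r, u) \<in> R ^^ d u" unfolding d_def using u(1) by (rule LeastI)
    then have "(r, v) \<in> R ^^ Suc (d u)" using u(2) by auto
    then have "d v \<le> Suc (d u)" unfolding d_def[of v] by (rule Least_le)
    moreover have "d u \<le> m" unfolding d_def using u(1) by (rule Least_le)
    ultimately show ?thesis using u(2) m by auto
  qed
  then have "\<forall>v. \<exists>u. (r, v) \<in> R\<^sup>* \<longrightarrow> v \<noteq> r \<longrightarrow> (u, v) \<in> R \<and> d v = Suc (d u)" by blast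
  then obtain par where "\<forall>v. (r, v) \<in> R\<^sup>* \<longrightarrow> v \<noteq> r \<longrightarrow> (par v, v) \<in> R \<and> d v = Suc (d (par v))"
    by metis
  then show thesis by (intro that[where d = d and par = par]) auto
qed

lemma card_le_1I:
  assumes "\<And>x y. x \<in> A \<Longrightarrow> y \<in> A \<Longrightarrow> x = y"
  shows "card A \<le> 1"
proof (cases "A = {}")
  case False
  then obtain a where "a \<in> A" by blast
  then have "A = {a}" using assms by blast
  then show ?thesis by simp
qed simp

subsection \<open>The simplicial boundary\<close>

lemma linear_order_vertex_order: "linear_order vertex_order"
proof -
  obtain r :: "'a rel" where "well_order_on UNIV r" using well_order_on by blast
  then have "linear_order r" by (simp add: well_order_on_def)
  then show ?thesis unfolding vertex_order_def by (rule someI)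
qed

text \<open>The incidence number of the face opposite to \<open>v\<close> in the boundary
  formula.\<close>

definition face_sign :: "'a set \<Rightarrow> 'a \<Rightarrow> int" where
  "face_sign \<sigma> v = (-1) ^ card {u \<in> \<sigma>. u \<noteq> v \<and> (u, v) \<in> vertex_order}"

lemma face_sign_cases: "face_sign \<sigma> v = 1 \<or> face_sign \<sigma> v = -1"
  unfolding face_sign_def by (metis neg_one_even_power neg_one_odd_power)

lemma face_sign_nonzero [simp]: "face_sign \<sigma> v \<noteq> 0"
  using face_sign_cases[of \<sigma> v] by auto

lemma simplicial_boundary_of:
  "simplicial_boundary (frag_of \<sigma>) = (\<Sum>v\<in>\<sigma>. frag_cmul (face_sign \<sigma> v) (frag_of (\<sigma> - {v})))"
  by (simp add: simplicial_boundary_def face_sign_def)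

lemma simplicial_boundary_0 [simp]: "simplicial_boundary 0 = 0"
  and simplicial_boundary_add: "simplicial_boundary (c + d) = simplicial_boundary c + simplicial_boundary d"
  and simplicial_boundary_diff: "simplicial_boundary (c - d) = simplicial_boundary c - simplicial_boundary d"
  and simplicial_boundary_cmul: "simplicial_boundary (frag_cmul k c) = frag_cmul k (simplicial_boundary c)"
  by (simp_all add: simplicial_boundary_def frag_extend_add frag_extend_diff frag_extend_cmul)

lemma simplicial_boundary_sum:
  "simplicial_boundary (\<Sum>i\<in>I. c i) = (\<Sum>i\<in>I. simplicial_boundary (c i))"
  by (induction I rule: infinite_finite_induct) (auto simp: simplicial_boundary_add)

text \<open>Deleting the smaller of the two vertices lowers the index of the larger one by one,
  while deleting the larger leaves the index of the smaller unchanged; so exactly one sign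
  flips.\<close>

lemma face_sign_anticommute:
  assumes "finite \<sigma>" "v \<in> \<sigma>" "w \<in> \<sigma>" "v \<noteq> w"
  shows "face_sign \<sigma> v * face_sign (\<sigma> - {v}) w = - (face_sign \<sigma> w * face_sign (\<sigma> - {w}) v)"
proof -
  have *: "face_sign \<sigma> v * face_sign (\<sigma> - {v}) w = - (face_sign \<sigma> w * face_sign (\<sigma> - {w}) v)"
    if "(v, w) \<in> vertex_order" "v \<noteq> w" "v \<in> \<sigma>" "w \<in> \<sigma>" for v w
  proof -
    have "(w, v) \<notin> vertex_order"
      using linear_order_vertex_order that
      by (auto simp: linear_order_on_def partial_order_on_def antisym_def)
    then have "{u \<in> \<sigma> - {w}. u \<noteq> v \<and> (u, v) \<in> vertex_order} = {u \<in> \<sigma>. u \<noteq> v \<and> (u, v) \<in> vertex_order}"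
      by auto
    moreover have "{u \<in> \<sigma>. u \<noteq> w \<and> (u, w) \<in> vertex_order}
        = insert v {u \<in> \<sigma> - {v}. u \<noteq> w \<and> (u, w) \<in> vertex_order}"
      using that by auto
    ultimately show ?thesis
      using \<open>finite \<sigma>\<close> by (simp add: face_sign_def)
  qed
  have "(v, w) \<in> vertex_order \<or> (w, v) \<in> vertex_order"
    using linear_order_vertex_order assms by (auto simp: linear_order_on_def total_on_def)
  then show ?thesis using *[of v w] *[of w v] assms by auto
qed

lemma simplicial_boundary_boundary_of:
  assumes "finite \<sigma>"
  shows "simplicial_boundary (simplicial_boundary (frag_of \<sigma>)) = 0"
proof (rule poly_mapping_eqI)
  fix \<rho>
  \<comment> \<open>Setting the diagonal to zero lets both vertices range over all of
    \<open>\<sigma>\<close>; the double sum is then antisymmetric under exchange of \<open>v\<close>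
    and \<open>w\<close>, hence equal to its own negative.\<close>
  let ?F = "\<lambda>v w. if v \<noteq> w then face_sign \<sigma> v * face_sign (\<sigma> - {v}) w *
      Poly_Mapping.lookup (frag_of (\<sigma> - {v} - {w})) \<rho> else 0"
  have "simplicial_boundary (simplicial_boundary (frag_of \<sigma>)) =
     (\<Sum>v\<in>\<sigma>. \<Sum>w\<in>\<sigma> - {v}. frag_cmul (face_sign \<sigma> v * face_sign (\<sigma> - {v}) w) (frag_of (\<sigma> - {v} - {w})))"
    by (simp add: simplicial_boundary_of simplicial_boundary_sum simplicial_boundary_cmul frag_cmul_sum)
  then have "Poly_Mapping.lookup (simplicial_boundary (simplicial_boundary (frag_of \<sigma>))) \<rho> =
     (\<Sum>v\<in>\<sigma>. \<Sum>w\<in>\<sigma> - {v}. ?F v w)"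
    by (simp add: lookup_sum) (intro sum.cong refl; auto)
  also have "\<dots> = (\<Sum>v\<in>\<sigma>. \<Sum>w\<in>\<sigma>. ?F v w)"
    using assms by (intro sum.cong refl sum.mono_neutral_left) auto
  finally have eq: "Poly_Mapping.lookup (simplicial_boundary (simplicial_boundary (frag_of \<sigma>))) \<rho> =
     (\<Sum>v\<in>\<sigma>. \<Sum>w\<in>\<sigma>. ?F v w)" .
  have "?F v w = - ?F w v" if "v \<in> \<sigma>" "w \<in> \<sigma>" for v w
    using face_sign_anticommute[OF assms that] by (auto simp: Diff_insert2[symmetric] insert_commute)
  then have "(\<Sum>v\<in>\<sigma>. \<Sum>w\<in>\<sigma>. ?F v w) = (\<Sum>v\<in>\<sigma>. \<Sum>w\<in>\<sigma>. - ?F w v)"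
    by (intro sum.cong refl) blast
  also have "\<dots> = - (\<Sum>w\<in>\<sigma>. \<Sum>v\<in>\<sigma>. ?F w v)"
    by (subst sum.swap) (simp only: sum_negf)
  finally have "(\<Sum>v\<in>\<sigma>. \<Sum>w\<in>\<sigma>. ?F v w) = 0" by linarith
  with eq show "Poly_Mapping.lookup (simplicial_boundary (simplicial_boundary (frag_of \<sigma>))) \<rho>
      = Poly_Mapping.lookup 0 \<rho>" by simp
qed

lemma simplicial_boundary_boundary:
  assumes "\<And>\<sigma>. \<sigma> \<in> Poly_Mapping.keys c \<Longrightarrow> finite \<sigma>"
  shows "simplicial_boundary (simplicial_boundary c) = 0"
proof -
  have "Poly_Mapping.keys c \<subseteq> Collect finite" using assms by auto
  then show ?thesis
    by (induction c rule: frag_induction)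
       (auto simp: simplicial_boundary_boundary_of simplicial_boundary_diff)
qed

lemma keys_simplicial_boundary:
  assumes "\<rho> \<in> Poly_Mapping.keys (simplicial_boundary c)"
  shows "\<exists>\<sigma>\<in>Poly_Mapping.keys c. \<exists>v\<in>\<sigma>. \<rho> = \<sigma> - {v}"
proof -
  have "\<rho> \<in> (\<Union>\<sigma>\<in>Poly_Mapping.keys c. Poly_Mapping.keys (simplicial_boundary (frag_of \<sigma>)))"
    using assms keys_frag_extend unfolding simplicial_boundary_def by fastforce
  then obtain \<sigma> where \<sigma>: "\<sigma> \<in> Poly_Mapping.keys c" "\<rho> \<in> Poly_Mapping.keys (simplicial_boundary (frag_of \<sigma>))"
    by blast
  have "Poly_Mapping.keys (simplicial_boundary (frag_of \<sigma>)) \<subseteq> (\<Union>v\<in>\<sigma>. {\<sigma> - {v}})"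
    unfolding simplicial_boundary_of
    by (rule order.trans[OF Poly_Mapping.keys_sum]) (auto simp: keys_frag_of)
  then show ?thesis using \<sigma> by blast
qed

lemma lookup_simplicial_boundary:
  "Poly_Mapping.lookup (simplicial_boundary c) \<rho> =
     (\<Sum>\<sigma>\<in>Poly_Mapping.keys c. Poly_Mapping.lookup c \<sigma> * Poly_Mapping.lookup (simplicial_boundary (frag_of \<sigma>)) \<rho>)"
  by (simp add: simplicial_boundary_def frag_extend_def lookup_sum)

lemma lookup_simplicial_boundary_of:
  assumes "finite \<sigma>" "v \<in> \<sigma>"
  shows "Poly_Mapping.lookup (simplicial_boundary (frag_of \<sigma>)) (\<sigma> - {v}) = face_sign \<sigma> v"
proof -
  have "Poly_Mapping.lookup (simplicial_boundary (frag_of \<sigma>)) (\<sigma> - {v})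
      = (\<Sum>w\<in>\<sigma>. if w = v then face_sign \<sigma> w else 0)"
    unfolding simplicial_boundary_of lookup_sum using assms by (intro sum.cong) auto
  then show ?thesis using assms by simp
qed

text \<open>Unfolds triviality of the quotient group into a statement about chains, the form in
  which acyclicity is applied below. Counting vertices instead of dimensions keeps the empty
  simplex, in degree -1, within the natural numbers.\<close>

lemma acyclic_complex_cycle:
  assumes "acyclic_complex K"
    and keys: "\<And>\<sigma>. \<sigma> \<in> Poly_Mapping.keys c \<Longrightarrow> \<sigma> \<in> insert {} K \<and> finite \<sigma> \<and> card \<sigma> = n"
    and cycle: "simplicial_boundary c = 0"
  obtains d where "Poly_Mapping.keys d \<subseteq> {\<sigma> \<in> insert {} K. card \<sigma> = n + 1}" "simplicial_boundary d = c"
proof -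
  define p where "p = int n - 1"
  let ?G = "simplicial_chain_group K p"
  let ?Z = "subgroup_generated ?G (simplicial_cycles K p)"
  let ?B = "simplicial_boundaries K p"
  have c: "c \<in> carrier ?G"
    using keys by (auto simp: simplicial_chain_group_def p_def)
  have "c \<in> simplicial_cycles K p"
    using c cycle by (simp add: simplicial_cycles_def kernel_def simplicial_chain_group_def)
  then have cZ: "c \<in> carrier ?Z"
    using c by (auto simp: carrier_subgroup_generated intro: generate.incl)
  have "carrier (?Z Mod ?B) = {?B}"
    using assms(1) by (auto simp: acyclic_complex_def trivial_group_def reduced_simplicial_homology_group_def)
  then have "r_coset ?Z ?B c = ?B"
    using cZ by (auto simp: carrier_FactGroup)
  moreover have "0 \<in> ?B"
  proof -
    have "simplicial_boundary 0 \<in> ?B"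
      unfolding simplicial_boundaries_def by (rule imageI) (simp add: simplicial_chain_group_def)
    then show ?thesis by simp
  qed
  \<comment> \<open>The coset of \<open>c\<close> contains \<open>c\<close>, as zero is a boundary;
    since that coset is the trivial one, \<open>c\<close> is a boundary.\<close>
  then have "0 \<otimes>\<^bsub>?Z\<^esub> c \<in> r_coset ?Z ?B c" by (auto simp: r_coset_def)
  then have "c \<in> r_coset ?Z ?B c"
    by (simp add: subgroup_generated_def simplicial_chain_group_def)
  ultimately have "c \<in> ?B" by simp
  then obtain d where "d \<in> carrier (simplicial_chain_group K (p + 1))" "simplicial_boundary d = c"
    by (auto simp: simplicial_boundaries_def)
  then show thesis
    by (intro that[of d]) (auto simp: simplicial_chain_group_def p_def)
qed

subsection \<open>Graded acyclic matchings\<close>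

lemma immediate_face_iff:
  assumes "finite \<tau>"
  shows "immediate_face \<sigma> \<tau> \<longleftrightarrow> (\<exists>v\<in>\<tau>. \<sigma> = \<tau> - {v})"
proof
  assume *: "immediate_face \<sigma> \<tau>"
  then have "card (\<tau> - \<sigma>) = 1"
    using assms card_Diff_subset[of \<sigma> \<tau>] finite_subset[of \<sigma> \<tau>] by (simp add: immediate_face_def)
  then obtain v where "\<tau> - \<sigma> = {v}" by (auto simp: card_1_singleton_iff)
  then show "\<exists>v\<in>\<tau>. \<sigma> = \<tau> - {v}" using * by (auto simp: immediate_face_def)
next
  assume "\<exists>v\<in>\<tau>. \<sigma> = \<tau> - {v}"
  then show "immediate_face \<sigma> \<tau>"
    using assms by (auto simp: immediate_face_def card_Suc_Diff1 simp del: card_Diff_insert)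
qed

lemma face_sign_singleton [simp]: "face_sign {x} x = 1"
proof -
  have "{u \<in> {x}. u \<noteq> x \<and> (u, x) \<in> vertex_order} = {}" by blast
  then show ?thesis unfolding face_sign_def by (simp only: card.empty power_0)
qed

lemma simplicial_boundary_of_vertex: "simplicial_boundary (frag_of {x}) = frag_of {}"
  by (simp add: simplicial_boundary_of)

text \<open>As a one-vertex simplex each endpoint carries sign 1, so anticommutation makes the two
  signs of the edge opposite. Which of them is positive depends on the unspecified vertex order, so
  the sign is carried along.\<close>

lemma simplicial_boundary_of_edge:
  assumes "x \<noteq> y"
  shows "simplicial_boundary (frag_of {x, y}) = frag_cmul (face_sign {x, y} x) (frag_of {y} - frag_of {x})"
proof (rule poly_mapping_eqI)
  fix \<rho>
  have diff: "{x, y} - {x} = {y}" "{x, y} - {y} = {x}" using assms by auto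
  have "face_sign {x, y} y = - face_sign {x, y} x"
    using face_sign_anticommute[of "{x, y}" x y] assms by (simp add: diff)
  then show "Poly_Mapping.lookup (simplicial_boundary (frag_of {x, y})) \<rho> =
      Poly_Mapping.lookup (frag_cmul (face_sign {x, y} x) (frag_of {y} - frag_of {x})) \<rho>"
    using assms by (simp add: simplicial_boundary_of diff lookup_add lookup_minus algebra_simps)
qed

text \<open>\<open>W\<close> is any relation that contains the gradient field and is single-valued
  in both directions, so the field need not be determined exactly.\<close>

lemma morse_functionI:
  assumes W: "\<And>\<sigma> \<tau>. \<sigma> \<in> K \<Longrightarrow> \<tau> \<in> K \<Longrightarrow> immediate_face \<sigma> \<tau> \<Longrightarrow> f \<tau> \<le> f \<sigma> \<Longrightarrow> (\<sigma>, \<tau>) \<in> W"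
    and up: "\<And>\<sigma> \<tau> \<tau>'. (\<sigma>, \<tau>) \<in> W \<Longrightarrow> (\<sigma>, \<tau>') \<in> W \<Longrightarrow> \<tau> = \<tau>'"
    and down: "\<And>\<sigma> \<sigma>' \<tau>. (\<sigma>, \<tau>) \<in> W \<Longrightarrow> (\<sigma>', \<tau>) \<in> W \<Longrightarrow> \<sigma> = \<sigma>'"
  shows "morse_function K f"
  unfolding morse_function_def
proof (intro ballI conjI card_le_1I)
  fix \<sigma> \<tau> \<tau>' assume "\<sigma> \<in> K"
  show "\<tau> = \<tau>'" if "\<tau> \<in> upward_exceptions K f \<sigma>" "\<tau>' \<in> upward_exceptions K f \<sigma>"
    using up[of \<sigma> \<tau> \<tau>'] W[OF \<open>\<sigma> \<in> K\<close>] that by (simp add: upward_exceptions_def)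
  show "\<tau> = \<tau>'" if "\<tau> \<in> downward_exceptions K f \<sigma>" "\<tau>' \<in> downward_exceptions K f \<sigma>"
    using down[of \<tau> \<sigma> \<tau>'] W[OF _ \<open>\<sigma> \<in> K\<close>] that by (simp add: downward_exceptions_def)
qed

text \<open>Abstracts from a Morse function to its gradient field \<open>V\<close> and a level
  function \<open>h\<close> with the properties of the normalization. Along a gradient path, which
  enters the upper simplex of a pair and leaves it through another face, \<open>h\<close> drops
  strictly, so \<open>V\<close> is acyclic. The level function is arbitrary because collapsing keeps
  \<open>h\<close> while \<open>K\<close> and \<open>V\<close> shrink.\<close>

locale graded_matching =
  fixes K :: "'a set set" and V :: "('a set \<times> 'a set) set" and h :: "'a set \<Rightarrow> nat"
  assumes complex: "finite_simplicial_complex K"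
    and card_le_3: "\<sigma> \<in> K \<Longrightarrow> card \<sigma> \<le> 3"
    and pairs: "(\<sigma>, \<tau>) \<in> V \<Longrightarrow> \<sigma> \<in> K \<and> \<tau> \<in> K \<and> immediate_face \<sigma> \<tau>"
    and up_unique: "(\<sigma>, \<tau>) \<in> V \<Longrightarrow> (\<sigma>, \<tau>') \<in> V \<Longrightarrow> \<tau> = \<tau>'"
    and down_unique: "(\<sigma>, \<tau>) \<in> V \<Longrightarrow> (\<sigma>', \<tau>) \<in> V \<Longrightarrow> \<sigma> = \<sigma>'"
    and not_both: "(\<rho>, \<sigma>) \<in> V \<Longrightarrow> (\<sigma>, \<tau>) \<notin> V"
    and level_eq: "(\<sigma>, \<tau>) \<in> V \<Longrightarrow> h \<sigma> = h \<tau>"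
    and level_less: "\<sigma> \<in> K \<Longrightarrow> \<tau> \<in> K \<Longrightarrow> immediate_face \<sigma> \<tau> \<Longrightarrow> (\<sigma>, \<tau>) \<notin> V \<Longrightarrow> h \<sigma> < h \<tau>"
begin

text \<open>Indexed by the number of vertices, not by dimension: 1, 2 and 3 stand for vertices,
  edges and triangles.\<close>

definition crit :: "nat \<Rightarrow> 'a set set" where
  "crit n = {\<sigma> \<in> K. card \<sigma> = n \<and> \<sigma> \<notin> Domain V \<and> \<sigma> \<notin> Range V}"

lemma finite_K: "finite K" and finite_simplex: "\<sigma> \<in> K \<Longrightarrow> finite \<sigma>"
  and nonempty_simplex: "\<sigma> \<in> K \<Longrightarrow> \<sigma> \<noteq> {}"
  and face_in_K: "\<sigma> \<in> K \<Longrightarrow> \<rho> \<subseteq> \<sigma> \<Longrightarrow> \<rho> \<noteq> {} \<Longrightarrow> \<rho> \<in> K"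
  using complex unfolding finite_simplicial_complex_def by blast+

lemma card_pos: "\<sigma> \<in> K \<Longrightarrow> card \<sigma> > 0"
  using finite_simplex nonempty_simplex by (simp add: card_gt_0_iff)

lemma card_cases: "\<sigma> \<in> K \<Longrightarrow> card \<sigma> = 1 \<or> card \<sigma> = 2 \<or> card \<sigma> = 3"
  using card_pos[of \<sigma>] card_le_3[of \<sigma>] by linarith

lemma card_pair: "(\<sigma>, \<tau>) \<in> V \<Longrightarrow> card \<tau> = card \<sigma> + 1"
  using pairs by (auto simp: immediate_face_def)

lemma finite_V: "finite V"
  by (rule finite_subset[of _ "K \<times> K"]) (use pairs finite_K in auto)

lemma finite_crit: "finite (crit n)"
  using finite_K by (simp add: crit_def)

lemma vertex_not_in_Range: "\<sigma> \<in> K \<Longrightarrow> card \<sigma> = 1 \<Longrightarrow> \<sigma> \<notin> Range V"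
  using card_pair card_pos pairs by fastforce

lemma triangle_not_in_Domain: "\<sigma> \<in> K \<Longrightarrow> card \<sigma> = 3 \<Longrightarrow> \<sigma> \<notin> Domain V"
  using card_pair card_le_3 pairs by fastforce

lemma sum_Domain: "(\<Sum>\<sigma>\<in>Domain V. w \<sigma>) = (\<Sum>p\<in>V. w (fst p))"
proof -
  have "inj_on fst V" using up_unique unfolding inj_on_def by (metis prod.collapse)
  then show ?thesis by (simp add: Domain_fst sum.reindex)
qed

lemma sum_Range: "(\<Sum>\<tau>\<in>Range V. w \<tau>) = (\<Sum>p\<in>V. w (snd p))"
proof -
  have "inj_on snd V" using down_unique unfolding inj_on_def by (metis prod.collapse)
  then show ?thesis by (simp add: Range_snd sum.reindex)
qed

text \<open>\<open>V\<close> is a bijection from the simplices paired upwards onto those paired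
  downwards. With \<open>P\<close> a level bound or \<open>True\<close>, this cancels the matched
  simplices from the counts below.\<close>

lemma card_matched_eq:
  assumes "\<And>\<sigma> \<tau>. (\<sigma>, \<tau>) \<in> V \<Longrightarrow> P \<sigma> \<longleftrightarrow> P \<tau>"
  shows "card {\<sigma> \<in> Domain V. card \<sigma> = n \<and> P \<sigma>} = card {\<tau> \<in> Range V. card \<tau> = n + 1 \<and> P \<tau>}"
proof -
  have "finite (Domain V)" "finite (Range V)"
    using finite_V by (simp_all add: finite_Domain finite_Range)
  then have "card {\<sigma> \<in> Domain V. card \<sigma> = n \<and> P \<sigma>} = (\<Sum>p\<in>V. if card (fst p) = n \<and> P (fst p) then 1 else 0)"
    and "card {\<tau> \<in> Range V. card \<tau> = n + 1 \<and> P \<tau>} = (\<Sum>p\<in>V. if card (snd p) = n + 1 \<and> P (snd p) then 1 else 0)"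
    using sum_Domain[of "\<lambda>\<sigma>. if card \<sigma> = n \<and> P \<sigma> then 1 else (0::nat)"]
      sum_Range[of "\<lambda>\<tau>. if card \<tau> = n + 1 \<and> P \<tau> then 1 else (0::nat)"]
    by (simp_all add: sum.If_cases Int_def)
  moreover have "(if card (fst p) = n \<and> P (fst p) then 1 else 0) = (if card (snd p) = n + 1 \<and> P (snd p) then 1 else (0::nat))"
    if "p \<in> V" for p
    using that assms[of "fst p" "snd p"] card_pair[of "fst p" "snd p"] by simp
  ultimately show ?thesis by simp
qed

text \<open>Critical and matched simplices partition \<open>K\<close>, and the two members of a pair
  cancel.\<close>

lemma sum_critical:
  fixes w :: "'a set \<Rightarrow> int"
  assumes "\<And>\<sigma> \<tau>. (\<sigma>, \<tau>) \<in> V \<Longrightarrow> w \<tau> = - w \<sigma>"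
  shows "(\<Sum>\<sigma>\<in>K. w \<sigma>) = (\<Sum>\<sigma>\<in>crit 1. w \<sigma>) + (\<Sum>\<sigma>\<in>crit 2. w \<sigma>) + (\<Sum>\<sigma>\<in>crit 3. w \<sigma>)"
proof -
  have fin: "finite (Domain V)" "finite (Range V)"
    using finite_V by (simp_all add: finite_Domain finite_Range)
  have K: "K = (crit 1 \<union> crit 2 \<union> crit 3) \<union> (Domain V \<union> Range V)"
    using card_cases pairs by (auto simp: crit_def)
  have "(\<Sum>\<sigma>\<in>K. w \<sigma>) = (\<Sum>\<sigma>\<in>crit 1 \<union> crit 2 \<union> crit 3. w \<sigma>) + (\<Sum>\<sigma>\<in>Domain V \<union> Range V. w \<sigma>)"
    by (subst K, rule sum.union_disjoint) (auto simp: crit_def fin finite_K)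
  also have "(\<Sum>\<sigma>\<in>Domain V \<union> Range V. w \<sigma>) = (\<Sum>p\<in>V. w (fst p) + w (snd p))"
    using not_both by (subst sum.union_disjoint) (auto simp: fin sum_Domain sum_Range sum.distrib)
  also have "\<dots> = 0"
    using assms by (intro sum.neutral) auto
  also have "(\<Sum>\<sigma>\<in>crit 1 \<union> crit 2 \<union> crit 3. w \<sigma>) = (\<Sum>\<sigma>\<in>crit 1. w \<sigma>) + (\<Sum>\<sigma>\<in>crit 2. w \<sigma>) + (\<Sum>\<sigma>\<in>crit 3. w \<sigma>)"
    by (subst sum.union_disjoint, auto simp: crit_def finite_K)+
  finally show ?thesis by simp
qed

lemma alternating_sum_critical:
  "(\<Sum>\<sigma>\<in>K. (-1) ^ simplex_dim \<sigma> * int (h \<sigma>)) =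
     int (\<Sum>\<sigma>\<in>crit 1. h \<sigma>) - int (\<Sum>\<sigma>\<in>crit 2. h \<sigma>) + int (\<Sum>\<sigma>\<in>crit 3. h \<sigma>)"
proof -
  have "(-1) ^ simplex_dim \<tau> * int (h \<tau>) = - ((-1) ^ simplex_dim \<sigma> * int (h \<sigma>))" if "(\<sigma>, \<tau>) \<in> V" for \<sigma> \<tau>
  proof -
    have "simplex_dim \<tau> = Suc (simplex_dim \<sigma>)"
      using card_pair[OF that] card_pos[of \<sigma>] pairs[OF that] by (simp add: simplex_dim_def)
    then show ?thesis using level_eq[OF that] by simp
  qed
  note sum_critical[of "\<lambda>\<sigma>. (-1) ^ simplex_dim \<sigma> * int (h \<sigma>)", OF this]
  moreover have "(\<Sum>\<sigma>\<in>crit n. (-1) ^ simplex_dim \<sigma> * int (h \<sigma>)) = (-1) ^ (n - 1) * int (\<Sum>\<sigma>\<in>crit n. h \<sigma>)" for n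
    by (simp add: sum_distrib_left simplex_dim_def crit_def)
  ultimately show ?thesis by simp
qed

text \<open>On chains supported on \<open>Range V\<close> the matrix of the boundary is triangular with respect to \<open>h\<close>,
  with the signs of the pairs on the diagonal.\<close>

lemma no_cycle_in_Range:
  assumes keys: "Poly_Mapping.keys z \<subseteq> Range V" and cycle: "simplicial_boundary z = 0"
  shows "z = 0"
proof (rule ccontr)
  assume "z \<noteq> 0"
  then have "Poly_Mapping.keys z \<noteq> {}" by simp
  then have "Max (h ` Poly_Mapping.keys z) \<in> h ` Poly_Mapping.keys z" by (intro Max_in) auto
  then obtain \<tau> where "\<tau> \<in> Poly_Mapping.keys z" "h \<tau> = Max (h ` Poly_Mapping.keys z)" by auto
  then have \<tau>: "\<tau> \<in> Poly_Mapping.keys z" "\<And>\<sigma>. \<sigma> \<in> Poly_Mapping.keys z \<Longrightarrow> h \<sigma> \<le> h \<tau>"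
    by simp_all
  obtain \<sigma> where \<sigma>: "(\<sigma>, \<tau>) \<in> V" using \<tau>(1) keys by blast
  then have K: "\<sigma> \<in> K" "\<tau> \<in> K" "immediate_face \<sigma> \<tau>" using pairs by auto
  then obtain v where v: "v \<in> \<tau>" "\<sigma> = \<tau> - {v}"
    using finite_simplex immediate_face_iff by metis
  \<comment> \<open>With \<open>\<tau>\<close> at the highest level of the support, any other
    simplex of the support over \<open>\<sigma>\<close> would lie strictly above that level; so
    \<open>\<sigma>\<close> receives only the term of \<open>\<tau>\<close>.\<close>
  have zero: "Poly_Mapping.lookup (simplicial_boundary (frag_of \<rho>)) \<sigma> = 0"
    if "\<rho> \<in> Poly_Mapping.keys z" "\<rho> \<noteq> \<tau>" for \<rho>
  proof (rule ccontr)
    assume "Poly_Mapping.lookup (simplicial_boundary (frag_of \<rho>)) \<sigma> \<noteq> 0"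
    then obtain w where w: "w \<in> \<rho>" "\<sigma> = \<rho> - {w}"
      using keys_simplicial_boundary[of \<sigma> "frag_of \<rho>"] by (auto simp: keys_frag_of in_keys_iff)
    have "\<rho> \<in> K" using that keys pairs by blast
    moreover from this w have "immediate_face \<sigma> \<rho>"
      using immediate_face_iff finite_simplex by metis
    moreover have "(\<sigma>, \<rho>) \<notin> V" using up_unique[OF \<sigma>] that by blast
    ultimately have "h \<sigma> < h \<rho>" using level_less K by blast
    then show False using \<tau>(2)[OF that(1)] level_eq[OF \<sigma>] by simp
  qed
  have "0 = Poly_Mapping.lookup (simplicial_boundary z) \<sigma>" using cycle by simp
  also have "\<dots> = (\<Sum>\<rho>\<in>Poly_Mapping.keys z. if \<rho> = \<tau> then Poly_Mapping.lookup z \<tau> * face_sign \<tau> v else 0)"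
    unfolding lookup_simplicial_boundary[of z \<sigma>]
  proof (rule sum.cong)
    fix \<rho> assume "\<rho> \<in> Poly_Mapping.keys z"
    then show "Poly_Mapping.lookup z \<rho> * Poly_Mapping.lookup (simplicial_boundary (frag_of \<rho>)) \<sigma>
        = (if \<rho> = \<tau> then Poly_Mapping.lookup z \<tau> * face_sign \<tau> v else 0)"
      using zero[of \<rho>] lookup_simplicial_boundary_of[OF finite_simplex[OF K(2)] v(1)] v(2) by simp
  qed simp
  also have "\<dots> = Poly_Mapping.lookup z \<tau> * face_sign \<tau> v" using \<tau>(1) by simp
  finally show False using \<tau>(1) by (simp add: in_keys_iff)
qed

section \<open>Critical triangles up to a given level\<close>

lemma two_cycle_trivial:
  assumes "acyclic_complex K" "Poly_Mapping.keys c \<subseteq> {\<sigma> \<in> K. card \<sigma> = 3}" "simplicial_boundary c = 0"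
  shows "c = 0"
proof -
  obtain d where d: "Poly_Mapping.keys d \<subseteq> {\<sigma> \<in> insert {} K. card \<sigma> = 3 + 1}" "simplicial_boundary d = c"
    using acyclic_complex_cycle[OF assms(1), of c 3] assms(2,3) finite_simplex by blast
  \<comment> \<open>No simplex has four vertices, so the chain \<open>d\<close> with boundary
    \<open>c\<close> is zero.\<close>
  have "{\<sigma> \<in> insert {} K. card \<sigma> = 3 + 1} = {}" using card_le_3 by fastforce
  then have "Poly_Mapping.keys d = {}" using d(1) by blast
  then have "d = 0" by simp
  then show ?thesis using d(2) by simp
qed

text \<open>Take one unknown per triangle up to level \<open>n\<close> and one equation per edge of
  \<open>B\<close>. If the triangles were in the majority, there would be a nonzero chain of them
  whose boundary lives on edges paired with vertices. No nonzero cycle does, so the chain would be a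
  2-cycle, against acyclicity.\<close>

lemma card_critical_triangles_le:
  assumes "acyclic_complex K"
  shows "card {t \<in> crit 3. h t \<le> n} \<le> card {e \<in> crit 2. h e < n}"
proof -
  define A where "A = {t \<in> K. card t = 3 \<and> h t \<le> n}"
  \<comment> \<open>The asymmetric bounds matter: edges paired with triangles count up to level
    \<open>n\<close>, critical edges only below \<open>n\<close>, because a critical edge lies
    strictly below each triangle containing it.\<close>
  define B where "B = {e \<in> K. card e = 2 \<and> e \<notin> Range V \<and> (e \<in> Domain V \<and> h e \<le> n \<or> h e < n)}"
  have fin: "finite A" "finite B" using finite_K by (auto simp: A_def B_def)
  have "card A \<le> card B"
  proof (rule ccontr)
    assume "\<not> card A \<le> card B"
    then obtain x where x: "\<exists>a\<in>A. x a \<noteq> 0"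
      "\<And>b. b \<in> B \<Longrightarrow> (\<Sum>a\<in>A. x a * Poly_Mapping.lookup (simplicial_boundary (frag_of a)) b) = 0"
      using integer_kernel_vector[OF fin(2,1), of "\<lambda>a. Poly_Mapping.lookup (simplicial_boundary (frag_of a))"]
      by auto
    define c where "c = (\<Sum>a\<in>A. frag_cmul (x a) (frag_of a))"
    have lookup_c: "Poly_Mapping.lookup c a = (if a \<in> A then x a else 0)" for a
    proof -
      have "Poly_Mapping.lookup c a = (\<Sum>b\<in>A. if b = a then x b else 0)"
        unfolding c_def lookup_sum by (intro sum.cong) auto
      then show ?thesis using fin by simp
    qed
    then have keys_c: "Poly_Mapping.keys c \<subseteq> A" by (auto simp: in_keys_iff split: if_splits)
    have "Poly_Mapping.keys (simplicial_boundary c) \<subseteq> Range V"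
    proof
      fix e assume e: "e \<in> Poly_Mapping.keys (simplicial_boundary c)"
      then obtain t v where tv: "t \<in> A" "v \<in> t" "e = t - {v}"
        using keys_simplicial_boundary keys_c by blast
      have t: "t \<in> K" "card t = 3" "h t \<le> n" using tv by (auto simp: A_def)
      have face: "immediate_face e t" using tv t finite_simplex immediate_face_iff by metis
      then have "card e = 2" using t by (simp add: immediate_face_def)
      moreover from this have "e \<noteq> {}" by auto
      then have "e \<in> K" using face_in_K[OF t(1), of e] tv by simp
      \<comment> \<open>An edge of \<open>t\<close> is either paired with \<open>t\<close>, at the
        same level, or strictly lower.\<close>
      moreover have "e \<in> Domain V \<and> h e \<le> n \<or> h e < n"
        using level_eq[of e t] level_less[of e t] face t calculation by (cases "(e, t) \<in> V") auto
      moreover have "e \<notin> B"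
      proof
        assume "e \<in> B"
        then have "Poly_Mapping.lookup (simplicial_boundary c) e = 0"
          using x(2) by (simp add: c_def simplicial_boundary_sum simplicial_boundary_cmul lookup_sum)
        then show False using e by (simp add: in_keys_iff)
      qed
      ultimately show "e \<in> Range V" by (auto simp: B_def)
    qed
    moreover have "simplicial_boundary (simplicial_boundary c) = 0"
      using keys_c finite_simplex by (intro simplicial_boundary_boundary) (auto simp: A_def)
    ultimately have "simplicial_boundary c = 0" by (rule no_cycle_in_Range)
    then have "c = 0" using two_cycle_trivial assms keys_c by (auto simp: A_def)
    then show False using x(1) lookup_c by (metis lookup_zero)
  qed
  \<comment> \<open>Besides critical simplices, \<open>A\<close> and \<open>B\<close> consist of the
    triangles and edges of the same pairs, those at level at most \<open>n\<close>, which
    cancel.\<close>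
  moreover have "card A = card {t \<in> crit 3. h t \<le> n} + card {t \<in> Range V. card t = 2 + 1 \<and> h t \<le> n}"
  proof -
    have "A = {t \<in> crit 3. h t \<le> n} \<union> {t \<in> Range V. card t = 2 + 1 \<and> h t \<le> n}"
      using triangle_not_in_Domain pairs by (auto simp: A_def crit_def)
    then show ?thesis using fin by (simp add: card_Un_disjoint crit_def Int_def)
  qed
  moreover have "card B = card {e \<in> crit 2. h e < n} + card {e \<in> Domain V. card e = 2 \<and> h e \<le> n}"
  proof -
    have "B = {e \<in> crit 2. h e < n} \<union> {e \<in> Domain V. card e = 2 \<and> h e \<le> n}"
      using not_both pairs by (fastforce simp: B_def crit_def)
    then show ?thesis using fin by (simp add: card_Un_disjoint crit_def Int_def)
  qed
  ultimately show ?thesis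
    using card_matched_eq[of "\<lambda>\<sigma>. h \<sigma> \<le> n" 2] level_eq by simp
qed

section \<open>Gradient paths and fundamental cycles\<close>

lemma matched_vertex_descends:
  assumes "({v}, e) \<in> V"
  obtains w where "e = {v, w}" "v \<noteq> w" "{w} \<in> K" "h {w} < h {v}"
proof -
  have e: "e \<in> K" "card e = 2" "v \<in> e"
    using pairs[OF assms] card_pair[OF assms] by (auto simp: immediate_face_def)
  then obtain w where w: "e = {v, w}" "v \<noteq> w" by (auto simp: card_2_iff)
  have wK: "{w} \<in> K" using face_in_K[OF e(1)] w by auto
  have "({w}, e) \<notin> V" using down_unique[OF assms] w by blast
  then have "h {w} < h {v}"
    using level_less[OF wK e(1)] level_eq[OF assms] w e by (simp add: immediate_face_def)
  then show thesis using that w wK by blast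
qed

text \<open>A vertex of least level cannot be matched, as its edge would lead to a lower
  vertex.\<close>

lemma critical_vertex_exists:
  assumes "K \<noteq> {}"
  shows "crit 1 \<noteq> {}"
proof -
  obtain \<sigma> x where "\<sigma> \<in> K" "x \<in> \<sigma>" using assms nonempty_simplex by blast
  then have x: "{x} \<in> K" using face_in_K by blast
  obtain v where v: "{v} \<in> K" "\<And>w. {w} \<in> K \<Longrightarrow> h {v} \<le> h {w}"
    using ex_has_least_nat[of "\<lambda>v. {v} \<in> K" x "\<lambda>v. h {v}"] x by blast
  have "{v} \<notin> Domain V"
  proof
    assume "{v} \<in> Domain V"
    then obtain e where e: "({v}, e) \<in> V" by blast
    then obtain w where w: "{w} \<in> K" "h {w} < h {v}"
      by (rule matched_vertex_descends)
    then show False using v(2)[OF w(1)] w(2) by simp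
  qed
  then have "{v} \<in> crit 1" using v vertex_not_in_Range[of "{v}"] by (simp add: crit_def)
  then show ?thesis by blast
qed

text \<open>Follow the gradient path from \<open>v\<close>: each vertex other than \<open>r\<close>
  is matched with an edge leading to a lower vertex, so the path ends in \<open>r\<close>. The chain
  consists of the edges used.\<close>

lemma chain_to_root:
  assumes root: "crit 1 = {{r}}" and "{v} \<in> K"
  shows "\<exists>p. Poly_Mapping.keys p \<subseteq> {e \<in> Range V. card e = 2} \<and> simplicial_boundary p = frag_of {v} - frag_of {r}"
  using assms(2)
proof (induction "h {v}" arbitrary: v rule: less_induct)
  case less
  show ?case
  proof (cases "v = r")
    case True
    then show ?thesis by (intro exI[of _ 0]) simp
  next
    case False
    then have "{v} \<notin> crit 1" using root by auto
    then obtain e where e: "({v}, e) \<in> V"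
      using less.prems vertex_not_in_Range[of "{v}"] by (auto simp: crit_def)
    then obtain w where w: "e = {v, w}" "v \<noteq> w" "{w} \<in> K" "h {w} < h {v}"
      by (rule matched_vertex_descends)
    then obtain p where p: "Poly_Mapping.keys p \<subseteq> {e \<in> Range V. card e = 2}"
      "simplicial_boundary p = frag_of {w} - frag_of {r}"
      using less.hyps w by blast
    \<comment> \<open>The sign with which \<open>e\<close> runs from \<open>w\<close> to
      \<open>v\<close>; it is its own inverse.\<close>
    define s where "s = face_sign {w, v} w"
    have s: "s * s = 1" using face_sign_cases[of "{w, v}" w] by (auto simp: s_def)
    have "simplicial_boundary (frag_of e) = frag_cmul s (frag_of {v} - frag_of {w})"
      using simplicial_boundary_of_edge[of w v] w by (simp add: s_def insert_commute)
    then have "simplicial_boundary (p + frag_cmul s (frag_of e)) = frag_of {v} - frag_of {r}"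
      using s p(2) by (simp add: simplicial_boundary_add simplicial_boundary_cmul)
    moreover have "Poly_Mapping.keys (p + frag_cmul s (frag_of e)) \<subseteq> {e \<in> Range V. card e = 2}"
      using p(1) e w by (intro order.trans[OF Poly_Mapping.keys_add]) (auto simp: keys_frag_of)
    ultimately show ?thesis by blast
  qed
qed

text \<open>The edge together with the gradient paths from its endpoints to \<open>r\<close> forms a
  cycle, which acyclicity fills with triangles. As the paths use only edges paired with vertices,
  \<open>e\<close> is the only other edge in the cycle.\<close>

lemma fundamental_cycle:
  assumes "acyclic_complex K" and root: "crit 1 = {{r}}" and e: "e \<in> K" "card e = 2" "e \<notin> Range V"
  shows "\<exists>c. Poly_Mapping.keys c \<subseteq> {t \<in> K. card t = 3} \<and>
    (\<forall>e'. e' \<notin> Range V \<longrightarrow> Poly_Mapping.lookup (simplicial_boundary c) e' = (if e' = e then 1 else 0))"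
proof -
  obtain x y where xy: "e = {x, y}" "x \<noteq> y" using e by (auto simp: card_2_iff)
  have xyK: "{x} \<in> K" "{y} \<in> K" using face_in_K[OF e(1)] xy by auto
  obtain p where p: "Poly_Mapping.keys p \<subseteq> {e \<in> Range V. card e = 2}"
    "simplicial_boundary p = frag_of {x} - frag_of {r}"
    using chain_to_root[OF root xyK(1)] by blast
  obtain q where q: "Poly_Mapping.keys q \<subseteq> {e \<in> Range V. card e = 2}"
    "simplicial_boundary q = frag_of {y} - frag_of {r}"
    using chain_to_root[OF root xyK(2)] by blast
  define s where "s = face_sign e x"
  define z where "z = frag_of e - frag_cmul s (q - p)"
  have boundary_z: "simplicial_boundary z = 0"
    using simplicial_boundary_of_edge[of x y] xy p q
    by (simp add: z_def s_def simplicial_boundary_diff simplicial_boundary_cmul)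
  have "Poly_Mapping.keys z \<subseteq> {e} \<union> (Poly_Mapping.keys q \<union> Poly_Mapping.keys p)"
    by (auto simp: z_def in_keys_iff lookup_minus split: if_splits)
  also have "\<dots> \<subseteq> {\<sigma> \<in> K. card \<sigma> = 2}"
    using p(1) q(1) e pairs by blast
  finally have "\<sigma> \<in> insert {} K \<and> finite \<sigma> \<and> card \<sigma> = 2" if "\<sigma> \<in> Poly_Mapping.keys z" for \<sigma>
    using that finite_simplex by blast
  from acyclic_complex_cycle[OF assms(1) this boundary_z] obtain c where
    c: "Poly_Mapping.keys c \<subseteq> {\<sigma> \<in> insert {} K. card \<sigma> = 2 + 1}" "simplicial_boundary c = z"
    by blast
  have "Poly_Mapping.lookup z e' = (if e' = e then 1 else 0)" if "e' \<notin> Range V" for e'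
  proof -
    have "Poly_Mapping.lookup p e' = 0" "Poly_Mapping.lookup q e' = 0"
      using that p(1) q(1) by (auto simp: in_keys_iff)
    then show ?thesis by (simp add: z_def lookup_minus)
  qed
  moreover have "Poly_Mapping.keys c \<subseteq> {t \<in> K. card t = 3}" using c(1) by auto
  ultimately show ?thesis using c(2) by blast
qed

text \<open>On \<open>E\<close> the boundaries of the fillings \<open>c e\<close> restrict to unit
  vectors, so the fillings are linearly independent chains of triangles and there are at most as
  many of them as triangles. Cancelling the pairs of edges and triangles leaves the critical
  simplices.\<close>

lemma card_critical_edges_le:
  assumes "acyclic_complex K" and root: "crit 1 = {{r}}"
  shows "card (crit 2) \<le> card (crit 3)"
proof -
  define E where "E = {e \<in> K. card e = 2 \<and> e \<notin> Range V}"
  define T where "T = {t \<in> K. card t = 3}"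
  have fin: "finite E" "finite T" using finite_K by (auto simp: E_def T_def)
  have "\<forall>e\<in>E. \<exists>c. Poly_Mapping.keys c \<subseteq> T \<and>
    (\<forall>e'. e' \<notin> Range V \<longrightarrow> Poly_Mapping.lookup (simplicial_boundary c) e' = (if e' = e then 1 else 0))"
    using fundamental_cycle[OF assms] by (auto simp: E_def T_def)
  then obtain c where c: "\<And>e. e \<in> E \<Longrightarrow> Poly_Mapping.keys (c e) \<subseteq> T"
    "\<And>e e'. e \<in> E \<Longrightarrow> e' \<notin> Range V \<Longrightarrow>
       Poly_Mapping.lookup (simplicial_boundary (c e)) e' = (if e' = e then 1 else 0)"
    by metis
  have "card E \<le> card T"
  proof (rule ccontr)
    assume "\<not> card E \<le> card T"
    then obtain x where x: "\<exists>e\<in>E. x e \<noteq> 0"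
      "\<And>t. t \<in> T \<Longrightarrow> (\<Sum>e\<in>E. x e * Poly_Mapping.lookup (c e) t) = 0"
      using integer_kernel_vector[OF fin(2,1), of "\<lambda>e. Poly_Mapping.lookup (c e)"] by auto
    have "(\<Sum>e\<in>E. frag_cmul (x e) (c e)) = 0"
    proof (rule poly_mapping_eqI)
      fix t
      show "Poly_Mapping.lookup (\<Sum>e\<in>E. frag_cmul (x e) (c e)) t = Poly_Mapping.lookup 0 t"
      proof (cases "t \<in> T")
        case True
        then show ?thesis using x(2) by (simp add: lookup_sum)
      next
        case False
        then have "Poly_Mapping.lookup (c e) t = 0" if "e \<in> E" for e
          using c(1)[OF that] by (auto simp: in_keys_iff)
        then show ?thesis by (simp add: lookup_sum)
      qed
    qed
    then have zero: "(\<Sum>e\<in>E. frag_cmul (x e) (simplicial_boundary (c e))) = 0"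
      by (metis (no_types, lifting) simplicial_boundary_0 simplicial_boundary_cmul simplicial_boundary_sum sum.cong)
    have "x e' = 0" if "e' \<in> E" for e'
    proof -
      have "0 = Poly_Mapping.lookup (\<Sum>e\<in>E. frag_cmul (x e) (simplicial_boundary (c e))) e'"
        using zero by simp
      also have "\<dots> = (\<Sum>e\<in>E. if e' = e then x e else 0)"
        unfolding lookup_sum using c(2)[of _ e'] that by (intro sum.cong) (auto simp: E_def)
      also have "\<dots> = x e'" using that fin by simp
      finally show ?thesis by simp
    qed
    then show False using x(1) by blast
  qed
  moreover have "card T = card (crit 3) + card {t \<in> Range V. card t = 2 + 1 \<and> True}"
  proof -
    have "T = crit 3 \<union> {t \<in> Range V. card t = 2 + 1 \<and> True}"
      using triangle_not_in_Domain pairs by (auto simp: T_def crit_def)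
    then show ?thesis using fin by (simp add: card_Un_disjoint crit_def Int_def)
  qed
  moreover have "card E = card (crit 2) + card {e \<in> Domain V. card e = 2 \<and> True}"
  proof -
    have "E = crit 2 \<union> {e \<in> Domain V. card e = 2 \<and> True}"
      using not_both pairs by (fastforce simp: E_def crit_def)
    then show ?thesis using fin by (simp add: card_Un_disjoint crit_def Int_def)
  qed
  ultimately show ?thesis
    using card_matched_eq[of "\<lambda>_. True" 2] by simp
qed

section \<open>Rematching the vertices along a spanning tree\<close>

definition unmatched_edges :: "'a rel" where
  "unmatched_edges = {(u, v). u \<noteq> v \<and> {u, v} \<in> K \<and> {u, v} \<notin> Domain V}"

text \<open>An edge paired with a triangle is replaced by the detour over the other two sides. These
  lie strictly below the triangle, hence below the edge, so the replacement terminates.\<close>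

lemma edge_endpoints_connected:
  assumes "{u, v} \<in> K" "u \<noteq> v"
  shows "(u, v) \<in> unmatched_edges\<^sup>*"
  using assms
proof (induction "h {u, v}" arbitrary: u v rule: less_induct)
  case less
  show ?case
  proof (cases "{u, v} \<in> Domain V")
    case False
    then show ?thesis using less.prems by (auto simp: unmatched_edges_def)
  next
    case True
    then obtain t where t: "({u, v}, t) \<in> V" by blast
    then have tK: "t \<in> K" "immediate_face {u, v} t" using pairs by auto
    then obtain w where w: "w \<in> t" "{u, v} = t - {w}"
      using immediate_face_iff finite_simplex by metis
    then have t_eq: "t = {u, v, w}" "w \<noteq> u" "w \<noteq> v" by auto
    have lower: "e \<in> K \<and> h e < h {u, v}" if "e = {u, w} \<or> e = {w, v}" for e
    proof -
      have "e \<noteq> {u, v}" using that t_eq less.prems by (auto simp: doubleton_eq_iff)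
      have "e \<in> K" using face_in_K[OF tK(1), of e] that t_eq by auto
      moreover have "immediate_face e t"
        using that t_eq less.prems by (auto simp: immediate_face_def)
      moreover have "(e, t) \<notin> V" using down_unique[OF t] \<open>e \<noteq> {u, v}\<close> by blast
      ultimately show ?thesis using level_less[of e t] level_eq[OF t] tK by simp
    qed
    have "(u, w) \<in> unmatched_edges\<^sup>*" "(w, v) \<in> unmatched_edges\<^sup>*"
      using less.hyps[of u w] less.hyps[of w v] lower[of "{u, w}"] lower[of "{w, v}"] t_eq by auto
    then show ?thesis by (rule rtrancl_trans)
  qed
qed

text \<open>Acyclicity in degree 0 makes the difference of two vertices the boundary of a chain of
  edges, and each edge has both endpoints in one component of the graph of unmatched edges.\<close>

lemma vertices_connected:
  assumes "acyclic_complex K" "{r} \<in> K" "{v} \<in> K"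
  shows "(r, v) \<in> unmatched_edges\<^sup>*"
proof -
  \<comment> \<open>The sum of the coefficients at the vertices reachable from \<open>r\<close>,
    with values in the free Abelian group on one generator, a copy of the integers.\<close>
  define \<phi> where "\<phi> = frag_extend (\<lambda>\<sigma>. if \<exists>u. \<sigma> = {u} \<and> (r, u) \<in> unmatched_edges\<^sup>* then frag_of () else 0)"
  have \<phi>_vertex: "\<phi> (frag_of {u}) = (if (r, u) \<in> unmatched_edges\<^sup>* then frag_of () else 0)" for u
    by (simp add: \<phi>_def)
  have cycle: "simplicial_boundary (frag_of {v} - frag_of {r}) = 0"
    by (simp add: simplicial_boundary_diff simplicial_boundary_of_vertex)
  have "\<sigma> \<in> insert {} K \<and> finite \<sigma> \<and> card \<sigma> = 1" if "\<sigma> \<in> Poly_Mapping.keys (frag_of {v} - frag_of {r})" for \<sigma>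
    using that keys_diff[of "frag_of {v}" "frag_of {r}"] assms by (auto simp: keys_frag_of)
  from acyclic_complex_cycle[OF assms(1) this cycle]
  obtain d where d: "Poly_Mapping.keys d \<subseteq> {\<sigma> \<in> insert {} K. card \<sigma> = 1 + 1}"
    "simplicial_boundary d = frag_of {v} - frag_of {r}"
    by blast
  from d(1) have "\<phi> (simplicial_boundary d) = 0"
  proof (induction d rule: frag_induction)
    case zero
    then show ?case by (simp add: \<phi>_def)
  next
    case (one \<sigma>)
    then have \<sigma>: "card \<sigma> = 2" "\<sigma> \<in> K" by auto
    obtain x y where xy: "\<sigma> = {x, y}" "x \<noteq> y" using \<sigma>(1) by (auto simp: card_2_iff)
    then have "(x, y) \<in> unmatched_edges\<^sup>*" "(y, x) \<in> unmatched_edges\<^sup>*"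
      using edge_endpoints_connected[of x y] edge_endpoints_connected[of y x] \<sigma>(2) by (auto simp: insert_commute)
    then have "(r, x) \<in> unmatched_edges\<^sup>* \<longleftrightarrow> (r, y) \<in> unmatched_edges\<^sup>*" by (meson rtrancl_trans)
    then have "\<phi> (frag_of {y} - frag_of {x}) = 0"
      unfolding \<phi>_def frag_extend_diff using \<phi>_vertex[unfolded \<phi>_def] by simp
    then show ?case
      using xy simplicial_boundary_of_edge[of x y] by (simp add: \<phi>_def frag_extend_cmul)
  next
    case (diff a b)
    then show ?case by (simp add: \<phi>_def simplicial_boundary_diff frag_extend_diff)
  qed
  moreover have "\<phi> (frag_of {v} - frag_of {r}) = \<phi> (frag_of {v}) - \<phi> (frag_of {r})"
    by (simp add: \<phi>_def frag_extend_diff)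
  ultimately show ?thesis
    using d(2) by (auto simp: \<phi>_vertex split: if_splits)
qed

text \<open>Keep the pairs of edges with triangles and match the vertices anew along a spanning tree of the
  remaining edges. The tree is rooted at \<open>r\<close> and grown by breadth-first search, so that the distance
  from the root serves as Morse function on it.\<close>

lemma morse_function_from_spanning_tree:
  assumes "acyclic_complex K" "{r} \<in> K"
  shows "\<exists>f. morse_function K f \<and>
    card (critical_simplices K f) + card (crit 1) \<le> card (crit 2) + card (crit 3) + 2"
proof -
  obtain d par where dp: "\<And>v. (r, v) \<in> unmatched_edges\<^sup>* \<Longrightarrow> v \<noteq> r \<Longrightarrow>
      (par v, v) \<in> unmatched_edges \<and> d v = Suc (d (par v))"
    by (rule rooted_distance[of r unmatched_edges]) blast
  define P where "P = {v. {v} \<in> K}"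
  define tree where "tree v = {par v, v}" for v
  define G where "G = {e \<in> K. card e = 2 \<and> e \<notin> Domain V}"
  have par: "par v \<noteq> v \<and> tree v \<in> G \<and> d v = Suc (d (par v))" if "v \<in> P - {r}" for v
    using dp[of v] vertices_connected[OF assms, of v] that
    by (auto simp: P_def G_def tree_def unmatched_edges_def)
  have P_card: "P = the_elem ` {\<sigma> \<in> K. card \<sigma> = 1}" "inj_on the_elem {\<sigma> \<in> K. card \<sigma> = 1}"
    by (force simp: P_def card_1_singleton_iff inj_on_def image_iff)+
  have fin: "finite P" "finite G" using P_card(1) finite_K by (auto simp: G_def)
  have inj: "inj_on tree (P - {r})"
  proof (rule inj_onI)
    fix u v assume "u \<in> P - {r}" "v \<in> P - {r}" "tree u = tree v"
    then show "u = v" using par[of u] par[of v] by (auto simp: tree_def doubleton_eq_iff)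
  qed
  define T where "T = tree ` (P - {r})"
  have T: "T \<subseteq> G" using par by (auto simp: T_def)
  obtain N where N: "\<And>v. v \<in> P \<Longrightarrow> d v < N"
    using fin(1) finite_nat_set_iff_bounded[of "d ` P"] by auto
  \<comment> \<open>Vertices and tree edges take the distance from the root, a tree edge that of its
    farther endpoint; everything else is lifted by \<open>N\<close> above them and ordered by
    \<open>h\<close>.\<close>
  define f where "f \<sigma> = (if card \<sigma> = 1 then d (the_elem \<sigma>) else if \<sigma> \<in> T then Max (d ` \<sigma>) else N + h \<sigma>)" for \<sigma>
  have f_vertex: "f {v} = d v" for v by (simp add: f_def)
  have f_tree: "f (tree v) = d v" if "v \<in> P - {r}" for v
    using par[OF that] that by (auto simp: f_def T_def tree_def)
  have f_other: "f \<sigma> = N + h \<sigma>" if "card \<sigma> \<noteq> 1" "\<sigma> \<notin> T" for \<sigma>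
    using that by (simp add: f_def)
  have T_card: "card \<sigma> = 2" if "\<sigma> \<in> T" for \<sigma> using T that by (auto simp: G_def)
  \<comment> \<open>The intended new gradient field: the old pairs of vertices with edges give way
    to the tree, the other pairs are kept.\<close>
  define W where "W = {({v}, tree v) |v. v \<in> P - {r}} \<union> {(e, t) \<in> V. card e = 2}"
  have W: "(\<sigma>, \<tau>) \<in> W" if \<sigma>: "\<sigma> \<in> K" and \<tau>: "\<tau> \<in> K" and face: "immediate_face \<sigma> \<tau>" and le: "f \<tau> \<le> f \<sigma>" for \<sigma> \<tau>
  proof -
    have card: "card \<tau> = card \<sigma> + 1" "\<sigma> \<subseteq> \<tau>" using face by (auto simp: immediate_face_def)
    consider "card \<sigma> = 1" | "card \<sigma> = 2" using card card_le_3[OF \<tau>] card_pos[OF \<sigma>] by linarith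
    then show ?thesis
    proof cases
      case 1
      then obtain u where u: "\<sigma> = {u}" by (auto simp: card_1_singleton_iff)
      then have uP: "u \<in> P" using \<sigma> by (simp add: P_def)
      have "\<tau> \<in> T"
      proof (rule ccontr)
        assume "\<tau> \<notin> T"
        then show False using f_other[of \<tau>] card 1 le N[OF uP] f_vertex[of u] u by simp
      qed
      then obtain v where v: "v \<in> P - {r}" "\<tau> = tree v" by (auto simp: T_def)
      then have "u = v \<or> u = par v" using card u by (auto simp: tree_def)
      \<comment> \<open>A tree edge has the value of its farther endpoint and so lies above its
        parent end.\<close>
      moreover have "u \<noteq> par v" using le f_tree[OF v(1)] f_vertex[of u] par[OF v(1)] u v by auto
      ultimately show ?thesis using u v by (auto simp: W_def)
    next
      case 2
      then have \<tau>_val: "f \<tau> = N + h \<tau>" using T_card[of \<tau>] card f_other[of \<tau>] by auto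
      have "\<sigma> \<notin> T"
      proof
        assume "\<sigma> \<in> T"
        then obtain v where "v \<in> P - {r}" "\<sigma> = tree v" by (auto simp: T_def)
        then show False using f_tree[of v] N[of v] \<tau>_val le by auto
      qed
      then have "h \<tau> \<le> h \<sigma>" using \<tau>_val le f_other[of \<sigma>] 2 by simp
      then have "(\<sigma>, \<tau>) \<in> V" using level_less[OF \<sigma> \<tau> face] by fastforce
      then show ?thesis using 2 by (simp add: W_def)
    qed
  qed
  have tree_no_triangle: "card (tree v) \<noteq> 3" if "v \<in> P - {r}" for v
    using par[OF that] by (auto simp: tree_def)
  have morse: "morse_function K (\<lambda>\<sigma>. real (f \<sigma>))"
  proof (rule morse_functionI[of K _ W])
    show "(\<sigma>, \<tau>) \<in> W" if "\<sigma> \<in> K" "\<tau> \<in> K" "immediate_face \<sigma> \<tau>" "real (f \<tau>) \<le> real (f \<sigma>)" for \<sigma> \<tau>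
      using W that by simp
    show "\<tau> = \<tau>'" if "(\<sigma>, \<tau>) \<in> W" "(\<sigma>, \<tau>') \<in> W" for \<sigma> \<tau> \<tau>'
    proof -
      have "\<tau> = tree (the_elem \<sigma>) \<and> card \<sigma> = 1 \<or> (\<sigma>, \<tau>) \<in> V \<and> card \<sigma> = 2" if "(\<sigma>, \<tau>) \<in> W" for \<tau>
        using that unfolding W_def by auto
      from this[OF that(1)] this[OF that(2)] show ?thesis using up_unique[of \<sigma> \<tau> \<tau>'] by auto
    qed
    show "\<sigma> = \<sigma>'" if "(\<sigma>, \<tau>) \<in> W" "(\<sigma>', \<tau>) \<in> W" for \<sigma> \<sigma>' \<tau>
    proof -
      have W_cases: "(\<exists>v\<in>P - {r}. \<sigma> = {v} \<and> \<tau> = tree v) \<and> card \<tau> \<noteq> 3 \<or> (\<sigma>, \<tau>) \<in> V \<and> card \<tau> = 3"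
        if "(\<sigma>, \<tau>) \<in> W" for \<sigma>
        using that tree_no_triangle card_pair[of \<sigma> \<tau>] unfolding W_def by auto
      from W_cases[OF that(1)] W_cases[OF that(2)] show ?thesis
        using down_unique[of \<sigma> \<tau> \<sigma>'] inj_onD[OF inj] by auto
    qed
  qed
  have "critical_simplices K (\<lambda>\<sigma>. real (f \<sigma>)) \<subseteq> insert {r} ((G - T) \<union> crit 3)"
  proof
    fix \<sigma> assume \<sigma>: "\<sigma> \<in> critical_simplices K (\<lambda>\<sigma>. real (f \<sigma>))"
    then have \<sigma>K: "\<sigma> \<in> K" by (simp add: critical_simplices_def)
    have fin_exc: "finite (upward_exceptions K (\<lambda>\<sigma>. real (f \<sigma>)) \<sigma>)" "finite (downward_exceptions K (\<lambda>\<sigma>. real (f \<sigma>)) \<sigma>)"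
      using finite_K by (simp_all add: upward_exceptions_def downward_exceptions_def)
    have no_up: "\<not> f \<tau> \<le> f \<sigma>" if "\<tau> \<in> K" "immediate_face \<sigma> \<tau>" for \<tau>
      using \<sigma> fin_exc that by (auto simp: critical_simplices_def upward_exceptions_def)
    have no_down: "\<not> f \<sigma> \<le> f \<rho>" if "\<rho> \<in> K" "immediate_face \<rho> \<sigma>" for \<rho>
      using \<sigma> fin_exc that by (auto simp: critical_simplices_def downward_exceptions_def)
    have pair_val: "f \<rho> = f \<tau>" if "(\<rho>, \<tau>) \<in> V" "card \<rho> = 2" for \<rho> \<tau>
    proof -
      have "\<rho> \<notin> T" using T that by (auto simp: G_def)
      moreover have "\<tau> \<notin> T" using T_card[of \<tau>] card_pair[OF that(1)] that(2) by auto
      ultimately show ?thesis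
        using f_other[of \<rho>] f_other[of \<tau>] that card_pair[OF that(1)] level_eq[OF that(1)] by simp
    qed
    consider "card \<sigma> = 1" | "card \<sigma> = 2" | "card \<sigma> = 3" using card_cases[OF \<sigma>K] by blast
    then show "\<sigma> \<in> insert {r} ((G - T) \<union> crit 3)"
    proof cases
      case 1
      then obtain v where v: "\<sigma> = {v}" by (auto simp: card_1_singleton_iff)
      have "v = r"
      proof (rule ccontr)
        assume "v \<noteq> r"
        then have vP: "v \<in> P - {r}" using v \<sigma>K by (auto simp: P_def)
        then have "tree v \<in> K" "immediate_face \<sigma> (tree v)"
          using par[OF vP] v by (auto simp: G_def immediate_face_def tree_def)
        then show False using no_up[of "tree v"] f_tree[OF vP] f_vertex[of v] v by auto
      qed
      then show ?thesis using v by simp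
    next
      case 2
      have "\<sigma> \<notin> Domain V"
      proof
        assume "\<sigma> \<in> Domain V"
        then obtain \<tau> where "(\<sigma>, \<tau>) \<in> V" by blast
        then show False using no_up[of \<tau>] pairs[of \<sigma> \<tau>] pair_val[of \<sigma> \<tau>] 2 by auto
      qed
      moreover have "\<sigma> \<notin> T"
      proof
        assume "\<sigma> \<in> T"
        then obtain v where v: "v \<in> P - {r}" "\<sigma> = tree v" by (auto simp: T_def)
        then have "{v} \<in> K" "immediate_face {v} \<sigma>"
          using par[OF v(1)] by (auto simp: P_def immediate_face_def tree_def)
        then show False using no_down[of "{v}"] f_tree[OF v(1)] f_vertex[of v] v by auto
      qed
      ultimately show ?thesis using 2 \<sigma>K by (auto simp: G_def)
    next
      case 3
      have "\<sigma> \<notin> Range V"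
      proof
        assume "\<sigma> \<in> Range V"
        then obtain \<rho> where "(\<rho>, \<sigma>) \<in> V" by blast
        then show False using no_down[of \<rho>] pairs[of \<rho> \<sigma>] pair_val[of \<rho> \<sigma>] card_pair[of \<rho> \<sigma>] 3 by auto
      qed
      then show ?thesis using 3 \<sigma>K triangle_not_in_Domain by (auto simp: crit_def)
    qed
  qed
  then have "card (critical_simplices K (\<lambda>\<sigma>. real (f \<sigma>))) \<le> card (insert {r} ((G - T) \<union> crit 3))"
    by (rule card_mono[rotated]) (simp add: fin finite_crit)
  also have "\<dots> \<le> Suc (card ((G - T) \<union> crit 3))"
    by (rule card_insert_le_m1) simp_all
  also have "\<dots> \<le> Suc (card (G - T) + card (crit 3))"
    using card_Un_le by blast
  finally have "card (critical_simplices K (\<lambda>\<sigma>. real (f \<sigma>))) \<le> Suc (card (G - T) + card (crit 3))" .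
  \<comment> \<open>A spanning tree has one edge fewer than vertices; together with the critical
    root this accounts for the summand 2.\<close>
  moreover have "card (G - T) + card P = card G + 1"
  proof -
    have "r \<in> P" using assms(2) by (simp add: P_def)
    then have "card T = card P - 1" "card P > 0"
      using fin unfolding T_def card_image[OF inj] by (auto simp: card_gt_0_iff)
    moreover have "card (G - T) = card G - card T" "card T \<le> card G"
      using T fin by (simp_all add: card_Diff_subset finite_subset card_mono)
    ultimately show ?thesis by linarith
  qed
  \<comment> \<open>The vertices and edges that \<open>V\<close> pairs with each other are equally
    many, so \<open>G\<close> and \<open>P\<close> differ in size exactly as critical edges and
    critical vertices do.\<close>
  moreover have "card P = card (crit 1) + card {\<sigma> \<in> Domain V. card \<sigma> = 1 \<and> True}"
  proof -
    have "card P = card {\<sigma> \<in> K. card \<sigma> = 1}" using P_card by (simp add: card_image)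
    also have "{\<sigma> \<in> K. card \<sigma> = 1} = crit 1 \<union> {\<sigma> \<in> Domain V. card \<sigma> = 1 \<and> True}"
      using vertex_not_in_Range pairs by (auto simp: crit_def)
    finally show ?thesis
      using finite_V by (subst (asm) card_Un_disjoint) (auto simp: finite_K crit_def finite_Domain)
  qed
  moreover have "card G = card (crit 2) + card {\<sigma> \<in> Range V. card \<sigma> = 1 + 1 \<and> True}"
  proof -
    have "G = crit 2 \<union> {\<sigma> \<in> Range V. card \<sigma> = 1 + 1 \<and> True}"
      using not_both pairs by (fastforce simp: G_def crit_def)
    then show ?thesis using fin by (simp add: card_Un_disjoint crit_def Int_def)
  qed
  ultimately show ?thesis
    using card_matched_eq[of "\<lambda>_. True" 1] morse by (intro exI[of _ "\<lambda>\<sigma>. real (f \<sigma>)"]) linarith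
qed

end

subsection \<open>Collapses\<close>

lemma finite_simplicial_complex_Diff:
  assumes "finite_simplicial_complex K" "\<And>\<rho>. \<rho> \<in> K \<Longrightarrow> \<sigma> \<subset> \<rho> \<Longrightarrow> \<rho> = \<tau>" "\<sigma> \<subset> \<tau>"
  shows "finite_simplicial_complex (K - {\<sigma>, \<tau>})"
  unfolding finite_simplicial_complex_def
proof (intro conjI ballI allI impI)
  fix \<rho> \<nu> assume \<rho>: "\<rho> \<in> K - {\<sigma>, \<tau>}" and \<nu>: "\<nu> \<subseteq> \<rho> \<and> \<nu> \<noteq> {}"
  have "\<nu> \<in> K" using \<rho> \<nu> assms(1) by (auto simp: finite_simplicial_complex_def)
  moreover have "\<nu> \<noteq> \<sigma>" "\<nu> \<noteq> \<tau>" using assms(2)[of \<rho>] assms(3) \<rho> \<nu> by auto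
  ultimately show "\<nu> \<in> K - {\<sigma>, \<tau>}" by simp
qed (use assms(1) in \<open>auto simp: finite_simplicial_complex_def\<close>)

text \<open>Induction on the number of simplices: collapsing a pair leaves a complex matched by the
  remaining pairs with the same levels, until only the unmatched vertex is left.\<close>

lemma collapsible_if_matched:
  assumes "graded_matching K V h" "{v} \<in> K" "\<And>\<sigma>. \<sigma> \<in> K \<Longrightarrow> \<sigma> \<in> Domain V \<or> \<sigma> \<in> Range V \<or> \<sigma> = {v}"
    and "{v} \<notin> Domain V"
  shows "elementary_collapse\<^sup>*\<^sup>* K {{v}}"
  using assms
proof (induction "card K" arbitrary: K V rule: less_induct)
  case less
  interpret graded_matching K V h by fact
  show ?case
  proof (cases "V = {}")
    case True
    then have "K = {{v}}" using less.prems(2,3) by blast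
    then show ?thesis by simp
  next
    case False
    \<comment> \<open>a pair at the highest level is free\<close>
    then obtain \<sigma> \<tau> where V: "(\<sigma>, \<tau>) \<in> V" and max: "\<And>\<sigma>' \<tau>'. (\<sigma>', \<tau>') \<in> V \<Longrightarrow> h \<sigma>' \<le> h \<sigma>"
    proof -
      have "Max (h ` Domain V) \<in> h ` Domain V"
        using False finite_V by (intro Max_in) (auto simp: finite_Domain)
      then obtain \<sigma> where "\<sigma> \<in> Domain V" "h \<sigma> = Max (h ` Domain V)"
        by (metis imageE)
      then obtain \<tau> where V: "(\<sigma>, \<tau>) \<in> V" by blast
      have "h \<sigma>' \<le> h \<sigma>" if "(\<sigma>', \<tau>') \<in> V" for \<sigma>' \<tau>'
        using that \<open>h \<sigma> = Max (h ` Domain V)\<close> finite_V by (auto simp: finite_Domain intro!: Max_ge)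
      then show ?thesis by (rule that[OF V])
    qed
    then have K: "\<sigma> \<in> K" "\<tau> \<in> K" "immediate_face \<sigma> \<tau>" using pairs by auto
    then have sub: "\<sigma> \<subset> \<tau>" by (auto simp: immediate_face_def)
    \<comment> \<open>Another immediate coface would lie strictly above \<open>\<sigma>\<close>;
      being matched, as it is no vertex, it would belong to a pair above the maximal level.\<close>
    have free_immediate: "\<rho> = \<tau>" if \<rho>: "\<rho> \<in> K" "immediate_face \<sigma> \<rho>" for \<rho>
    proof (rule ccontr)
      assume "\<rho> \<noteq> \<tau>"
      then have "(\<sigma>, \<rho>) \<notin> V" using up_unique[OF V] by blast
      then have less: "h \<sigma> < h \<rho>" using level_less K \<rho> by blast
      have "\<rho> \<noteq> {v}" using \<rho> K(1) nonempty_simplex card_pos[OF K(1)] by (auto simp: immediate_face_def)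
      then obtain \<rho>' where "(\<rho>, \<rho>') \<in> V \<or> (\<rho>', \<rho>) \<in> V" using less.prems(3)[OF \<rho>(1)] by blast
      then show False using max level_eq less by fastforce
    qed
    \<comment> \<open>Passes from immediate to arbitrary cofaces: every vertex of
      \<open>\<rho>\<close> outside \<open>\<sigma>\<close> must be the one vertex of
      \<open>\<tau>\<close> outside \<open>\<sigma>\<close>.\<close>
    have free: "\<rho> = \<tau>" if \<rho>: "\<rho> \<in> K" "\<sigma> \<subset> \<rho>" for \<rho>
    proof -
      have add: "insert x \<sigma> = \<tau>" if "x \<in> \<rho> - \<sigma>" for x
      proof (rule free_immediate)
        show "insert x \<sigma> \<in> K" using face_in_K[OF \<rho>(1)] that \<rho>(2) by auto
        show "immediate_face \<sigma> (insert x \<sigma>)" using that finite_simplex[OF K(1)] by (auto simp: immediate_face_def)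
      qed
      obtain x where x: "x \<in> \<rho> - \<sigma>" using \<rho>(2) by blast
      have "y = x" if y: "y \<in> \<rho> - \<sigma>" for y
      proof -
        have "y \<in> insert x \<sigma>" using add[OF x] add[OF y] by auto
        then show ?thesis using y by simp
      qed
      then have "\<rho> = insert x \<sigma>" using x \<rho>(2) by blast
      then show ?thesis using add[OF x] by simp
    qed
    let ?L = "K - {\<sigma>, \<tau>}"
    let ?V = "V - {(\<sigma>, \<tau>)}"
    have V_L: "\<rho> \<noteq> \<sigma> \<and> \<rho> \<noteq> \<tau> \<and> \<rho>' \<noteq> \<sigma> \<and> \<rho>' \<noteq> \<tau>" if "(\<rho>, \<rho>') \<in> ?V" for \<rho> \<rho>'
    proof -
      have \<rho>: "(\<rho>, \<rho>') \<in> V" "(\<rho>, \<rho>') \<noteq> (\<sigma>, \<tau>)" using that by simp_all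
      have "\<rho> \<noteq> \<sigma>" using up_unique[OF V] \<rho> by metis
      moreover have "\<rho>' \<noteq> \<tau>" using down_unique[OF V] \<rho> by metis
      ultimately show ?thesis using not_both V \<rho>(1) by metis
    qed
    have "graded_matching ?L ?V h"
    proof
      show "finite_simplicial_complex ?L"
        using finite_simplicial_complex_Diff[OF complex free sub] by blast
      show "card \<rho> \<le> 3" if "\<rho> \<in> ?L" for \<rho> using that card_le_3 by blast
      show "\<rho> \<in> ?L \<and> \<rho>' \<in> ?L \<and> immediate_face \<rho> \<rho>'" if "(\<rho>, \<rho>') \<in> ?V" for \<rho> \<rho>'
        using that V_L[OF that] pairs by blast
      show "\<rho>' = \<rho>''" if "(\<rho>, \<rho>') \<in> ?V" "(\<rho>, \<rho>'') \<in> ?V" for \<rho> \<rho>' \<rho>''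
        using that up_unique[of \<rho> \<rho>' \<rho>''] by blast
      show "\<rho> = \<rho>''" if "(\<rho>, \<rho>') \<in> ?V" "(\<rho>'', \<rho>') \<in> ?V" for \<rho> \<rho>' \<rho>''
        using that down_unique[of \<rho> \<rho>' \<rho>''] by blast
      show "(\<rho>', \<rho>'') \<notin> ?V" if "(\<rho>, \<rho>') \<in> ?V" for \<rho> \<rho>' \<rho>''
        using that not_both[of \<rho> \<rho>' \<rho>''] by blast
      show "h \<rho> = h \<rho>'" if "(\<rho>, \<rho>') \<in> ?V" for \<rho> \<rho>'
        using that level_eq by blast
      show "h \<rho> < h \<rho>'" if "\<rho> \<in> ?L" "\<rho>' \<in> ?L" "immediate_face \<rho> \<rho>'" "(\<rho>, \<rho>') \<notin> ?V" for \<rho> \<rho>'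
        using that level_less by blast
    qed
    moreover have "{v} \<noteq> \<tau>"
      using sub nonempty_simplex[OF K(1)] by auto
    then have "{v} \<in> ?L" using less.prems(2,4) V by auto
    moreover have "\<rho> \<in> Domain ?V \<or> \<rho> \<in> Range ?V \<or> \<rho> = {v}" if "\<rho> \<in> ?L" for \<rho>
      using that less.prems(3)[of \<rho>] by blast
    moreover have "{v} \<notin> Domain ?V" using less.prems(4) by blast
    moreover have "card ?L < card K"
      using K finite_K by (intro psubset_card_mono) auto
    ultimately have "elementary_collapse\<^sup>*\<^sup>* ?L {{v}}" using less.hyps[of ?L ?V] by blast
    moreover have "elementary_collapse K ?L"
      unfolding elementary_collapse_def using K free by blast
    ultimately show ?thesis by (rule converse_rtranclp_into_rtranclp[rotated])
  qed
qed

subsection \<open>The normalization of a Morse function\<close>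

lemma morse_function_unique_up:
  assumes "finite K" "morse_function K f" "(\<sigma>, \<tau>) \<in> gradient_field K f" "(\<sigma>, \<tau>') \<in> gradient_field K f"
  shows "\<tau> = \<tau>'"
proof -
  have "card (upward_exceptions K f \<sigma>) \<le> Suc 0" "finite (upward_exceptions K f \<sigma>)"
    using assms by (auto simp: morse_function_def gradient_field_def upward_exceptions_def)
  moreover have "\<tau> \<in> upward_exceptions K f \<sigma>" "\<tau>' \<in> upward_exceptions K f \<sigma>"
    using assms by (auto simp: gradient_field_def upward_exceptions_def)
  ultimately show ?thesis by (simp add: card_le_Suc0_iff_eq)
qed

lemma morse_function_unique_down:
  assumes "finite K" "morse_function K f" "(\<sigma>, \<tau>) \<in> gradient_field K f" "(\<sigma>', \<tau>) \<in> gradient_field K f"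
  shows "\<sigma> = \<sigma>'"
proof -
  have "card (downward_exceptions K f \<tau>) \<le> Suc 0" "finite (downward_exceptions K f \<tau>)"
    using assms by (auto simp: morse_function_def gradient_field_def downward_exceptions_def)
  moreover have "\<sigma> \<in> downward_exceptions K f \<tau>" "\<sigma>' \<in> downward_exceptions K f \<tau>"
    using assms by (auto simp: gradient_field_def downward_exceptions_def)
  ultimately show ?thesis by (simp add: card_le_Suc0_iff_eq)
qed

text \<open>Two vertices separate \<open>\<nu>\<close> from \<open>\<tau>\<close>, and removing them
  in the other order passes through a different simplex.\<close>

lemma intermediate_face:
  assumes "finite_simplicial_complex K" "\<tau> \<in> K" "\<nu> \<in> K" "immediate_face \<nu> \<sigma>" "immediate_face \<sigma> \<tau>"
  obtains \<sigma>' where "\<sigma>' \<in> K" "\<sigma>' \<noteq> \<sigma>" "immediate_face \<nu> \<sigma>'" "immediate_face \<sigma>' \<tau>"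
proof -
  have fin: "finite \<tau>" using assms(1,2) by (simp add: finite_simplicial_complex_def)
  have ne: "\<nu> \<noteq> {}" using assms(1,3) by (simp add: finite_simplicial_complex_def)
  obtain y where y: "y \<in> \<tau>" "\<sigma> = \<tau> - {y}"
    using assms(5) unfolding immediate_face_iff[OF fin] by blast
  then have "finite \<sigma>" using fin by simp
  then obtain x where x: "x \<in> \<sigma>" "\<nu> = \<sigma> - {x}"
    using assms(4) unfolding immediate_face_iff[OF \<open>finite \<sigma>\<close>] by blast
  show thesis
  proof (rule that)
    have "\<tau> - {x} \<noteq> {}" using ne x y by auto
    then show "\<tau> - {x} \<in> K"
      using assms(1,2) Diff_subset[of \<tau> "{x}"] unfolding finite_simplicial_complex_def by blast
    show "\<tau> - {x} \<noteq> \<sigma>" using x y by auto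
    have "finite (\<tau> - {x})" using fin by simp
    then show "immediate_face \<nu> (\<tau> - {x})"
      by (subst immediate_face_iff) (use x y in \<open>auto intro!: bexI[of _ y]\<close>)
    show "immediate_face (\<tau> - {x}) \<tau>"
      unfolding immediate_face_iff[OF fin] using x y by blast
  qed
qed

text \<open>Through \<open>\<sigma>\<close> the function would not increase from
  \<open>\<nu>\<close> to \<open>\<tau>\<close>; through the other intermediate simplex, which is
  paired with neither, it would increase strictly.\<close>

lemma morse_function_not_both:
  assumes K: "finite_simplicial_complex K" and f: "morse_function K f"
    and \<nu>: "(\<nu>, \<sigma>) \<in> gradient_field K f"
  shows "(\<sigma>, \<tau>) \<notin> gradient_field K f"
proof
  assume \<tau>: "(\<sigma>, \<tau>) \<in> gradient_field K f"
  have fin: "finite K" using K by (simp add: finite_simplicial_complex_def)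
  obtain \<sigma>' where \<sigma>': "\<sigma>' \<in> K" "\<sigma>' \<noteq> \<sigma>" "immediate_face \<nu> \<sigma>'" "immediate_face \<sigma>' \<tau>"
    using intermediate_face[OF K, of \<tau> \<nu> \<sigma>] \<nu> \<tau> by (auto simp: gradient_field_def)
  have "(\<nu>, \<sigma>') \<notin> gradient_field K f" "(\<sigma>', \<tau>) \<notin> gradient_field K f"
    using morse_function_unique_up[OF fin f \<nu>, of \<sigma>'] morse_function_unique_down[OF fin f \<tau>, of \<sigma>'] \<sigma>' by auto
  then show False using \<nu> \<tau> \<sigma>' by (auto simp: gradient_field_def)
qed

lemma critical_simplices_eq:
  assumes "finite K"
  shows "critical_simplices K f = {\<sigma> \<in> K. \<sigma> \<notin> Domain (gradient_field K f) \<and> \<sigma> \<notin> Range (gradient_field K f)}"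
  using assms
  by (auto simp: critical_simplices_def upward_exceptions_def downward_exceptions_def gradient_field_def)

lemma morse_function_cong:
  assumes "gradient_field K f = gradient_field K g" "morse_function K f"
  shows "morse_function K g"
proof -
  have "upward_exceptions K f \<sigma> = {\<tau>. (\<sigma>, \<tau>) \<in> gradient_field K f}"
    "downward_exceptions K f \<sigma> = {\<tau>. (\<tau>, \<sigma>) \<in> gradient_field K f}" if "\<sigma> \<in> K" for f :: "'a set \<Rightarrow> real" and \<sigma>
    using that by (auto simp: gradient_field_def upward_exceptions_def downward_exceptions_def)
  then show ?thesis using assms by (simp add: morse_function_def)
qed

lemma nat_equivalents_iff:
  "g \<in> nat_equivalents K f \<longleftrightarrow> morse_function K f \<and>
     (\<forall>\<sigma>\<in>K. \<forall>\<tau>\<in>K. immediate_face \<sigma> \<tau> \<longrightarrow> (g \<tau> \<le> g \<sigma> \<longleftrightarrow> f \<tau> \<le> f \<sigma>))"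
proof -
  have "gradient_field K f = gradient_field K (\<lambda>\<sigma>. real (g \<sigma>)) \<longleftrightarrow>
     (\<forall>\<sigma>\<in>K. \<forall>\<tau>\<in>K. immediate_face \<sigma> \<tau> \<longrightarrow> (g \<tau> \<le> g \<sigma> \<longleftrightarrow> f \<tau> \<le> f \<sigma>))"
    by (auto simp: gradient_field_def set_eq_iff)
  then show ?thesis
    unfolding nat_equivalents_def equivalent_morse_def using morse_function_cong by blast
qed

lemma nat_equivalents_nonempty:
  assumes "finite K" "morse_function K f"
  shows "nat_equivalents K f \<noteq> {}"
proof -
  \<comment> \<open>The rank of a value among the finitely many values of \<open>f\<close> keeps all
    comparisons.\<close>
  let ?g = "\<lambda>\<sigma>. card {x \<in> f ` K. x < f \<sigma>}"
  have "?g \<tau> \<le> ?g \<sigma> \<longleftrightarrow> f \<tau> \<le> f \<sigma>" if "\<sigma> \<in> K" for \<sigma> \<tau>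
  proof
    show "?g \<tau> \<le> ?g \<sigma>" if "f \<tau> \<le> f \<sigma>" using assms(1) that by (intro card_mono) auto
    show "f \<tau> \<le> f \<sigma>" if "?g \<tau> \<le> ?g \<sigma>"
    proof (rule ccontr)
      assume "\<not> f \<tau> \<le> f \<sigma>"
      then have "?g \<sigma> < ?g \<tau>"
        using assms(1) \<open>\<sigma> \<in> K\<close> by (intro psubset_card_mono) (auto simp: psubset_eq)
      then show False using that by simp
    qed
  qed
  then have "?g \<in> nat_equivalents K f" using assms(2) by (simp add: nat_equivalents_iff)
  then show ?thesis by blast
qed

lemma normalization_le: "g \<in> nat_equivalents K f \<Longrightarrow> normalization K f \<sigma> \<le> g \<sigma>"
  unfolding normalization_def by (rule Least_le) blast

lemma normalization_attained:
  assumes "finite K" "morse_function K f"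
  obtains g where "g \<in> nat_equivalents K f" "normalization K f \<sigma> = g \<sigma>"
proof -
  have "\<exists>n. \<exists>g\<in>nat_equivalents K f. n = g \<sigma>"
    using nat_equivalents_nonempty[OF assms] by blast
  then have "\<exists>g\<in>nat_equivalents K f. normalization K f \<sigma> = g \<sigma>"
    unfolding normalization_def by (rule LeastI_ex)
  then show thesis using that by blast
qed

text \<open>The minimum is taken simplex by simplex, so different functions may attain it on the two
  members of an incident pair. A function that attains it on the side meant to be larger settles the
  comparison, since minimality bounds the value on the other side.\<close>

lemma normalization_equivalent:
  assumes "finite K" "morse_function K f"
  shows "normalization K f \<in> nat_equivalents K f"
  unfolding nat_equivalents_iff
proof (intro conjI ballI impI)
  fix \<sigma> \<tau> assume K: "\<sigma> \<in> K" "\<tau> \<in> K" "immediate_face \<sigma> \<tau>"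
  obtain g where g: "g \<in> nat_equivalents K f" "normalization K f \<sigma> = g \<sigma>"
    using normalization_attained[OF assms] .
  obtain g' where g': "g' \<in> nat_equivalents K f" "normalization K f \<tau> = g' \<tau>"
    using normalization_attained[OF assms] .
  have "g \<tau> \<le> g \<sigma> \<longleftrightarrow> f \<tau> \<le> f \<sigma>" "g' \<tau> \<le> g' \<sigma> \<longleftrightarrow> f \<tau> \<le> f \<sigma>"
    using g(1) g'(1) K unfolding nat_equivalents_iff by blast+
  then show "normalization K f \<tau> \<le> normalization K f \<sigma> \<longleftrightarrow> f \<tau> \<le> f \<sigma>"
    using normalization_le[OF g(1), of \<tau>] normalization_le[OF g'(1), of \<sigma>] g(2) g'(2) by linarith
qed (rule assms(2))

text \<open>Otherwise lowering the value of \<open>\<sigma>\<close> alone to \<open>n\<close> would give a smaller equivalent Morse function.\<close>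

lemma normalization_le_if_lowerable:
  assumes K: "finite K" and f: "morse_function K f" and "n \<le> normalization K f \<sigma>"
    and up: "\<And>\<tau>. \<tau> \<in> K \<Longrightarrow> immediate_face \<sigma> \<tau> \<Longrightarrow> f \<tau> \<le> f \<sigma> \<Longrightarrow> normalization K f \<tau> \<le> n"
    and down: "\<And>\<nu>. \<nu> \<in> K \<Longrightarrow> immediate_face \<nu> \<sigma> \<Longrightarrow> f \<nu> < f \<sigma> \<and> normalization K f \<nu> < n"
  shows "normalization K f \<sigma> \<le> n"
proof -
  let ?h = "normalization K f"
  have h: "?h \<tau> \<le> ?h \<rho> \<longleftrightarrow> f \<tau> \<le> f \<rho>" if "\<rho> \<in> K" "\<tau> \<in> K" "immediate_face \<rho> \<tau>" for \<rho> \<tau>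
    using normalization_equivalent[OF K f] that unfolding nat_equivalents_iff by blast
  have "?h(\<sigma> := n) \<in> nat_equivalents K f"
    unfolding nat_equivalents_iff
  proof (intro conjI ballI impI)
    fix \<rho> \<tau> assume \<rho>\<tau>: "\<rho> \<in> K" "\<tau> \<in> K" "immediate_face \<rho> \<tau>"
    then have "\<rho> \<noteq> \<tau>" by (auto simp: immediate_face_def)
    then consider "\<rho> = \<sigma>" "\<tau> \<noteq> \<sigma>" | "\<tau> = \<sigma>" "\<rho> \<noteq> \<sigma>" | "\<rho> \<noteq> \<sigma>" "\<tau> \<noteq> \<sigma>" by blast
    then show "(?h(\<sigma> := n)) \<tau> \<le> (?h(\<sigma> := n)) \<rho> \<longleftrightarrow> f \<tau> \<le> f \<rho>"
    proof cases
      case 1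
      then show ?thesis using up[of \<tau>] h[OF \<rho>\<tau>] \<rho>\<tau> assms(3) by auto
    next
      case 2
      then show ?thesis using down[of \<rho>] \<rho>\<tau> by auto
    next
      case 3
      then show ?thesis using h[OF \<rho>\<tau>] by simp
    qed
  qed (rule f)
  from normalization_le[OF this, of \<sigma>] show ?thesis by simp
qed

lemma normalization_critical_vertex:
  assumes "finite_simplicial_complex K" "morse_function K f" "\<sigma> \<in> critical_simplices K f" "card \<sigma> = 1"
  shows "normalization K f \<sigma> = 0"
proof -
  have fin: "finite K" using assms(1) by (simp add: finite_simplicial_complex_def)
  have "normalization K f \<sigma> \<le> 0"
  proof (rule normalization_le_if_lowerable[OF fin assms(2)])
    show "normalization K f \<tau> \<le> 0" if "\<tau> \<in> K" "immediate_face \<sigma> \<tau>" "f \<tau> \<le> f \<sigma>" for \<tau>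
      using assms(3) that unfolding critical_simplices_eq[OF fin] by (auto simp: gradient_field_def)
    \<comment> \<open>A vertex has no immediate face in \<open>K\<close>, since the empty simplex is
      not a member.\<close>
    show "f \<nu> < f \<sigma> \<and> normalization K f \<nu> < 0" if "\<nu> \<in> K" "immediate_face \<nu> \<sigma>" for \<nu>
    proof -
      have "card \<nu> = 0" using that(2) assms(4) by (simp add: immediate_face_def)
      moreover have "finite \<nu>" "\<nu> \<noteq> {}" using that(1) assms(1) unfolding finite_simplicial_complex_def by blast+
      ultimately show ?thesis by simp
    qed
  qed simp
  then show ?thesis by simp
qed

text \<open>The value at \<open>\<sigma>\<close> can be lowered to that at \<open>\<tau>\<close> if
  every immediate face \<open>\<nu>\<close> of \<open>\<sigma>\<close> has a smaller value. Such a
  \<open>\<nu>\<close> lies in a second immediate face \<open>\<sigma>'\<close> of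
  \<open>\<tau>\<close>, whose value is below that of \<open>\<tau>\<close>; and
  \<open>\<nu>\<close> does not exceed \<open>\<sigma>'\<close>, by induction if these two are
  paired.\<close>

lemma normalization_matched:
  assumes K: "finite_simplicial_complex K" and dim: "\<And>\<sigma>. \<sigma> \<in> K \<Longrightarrow> card \<sigma> \<le> 3" and f: "morse_function K f"
    and "(\<sigma>, \<tau>) \<in> gradient_field K f"
  shows "normalization K f \<sigma> = normalization K f \<tau>"
  using assms(4)
proof (induction "card \<sigma>" arbitrary: \<sigma> \<tau> rule: less_induct)
  case less
  let ?h = "normalization K f"
  have fin: "finite K" using K by (simp add: finite_simplicial_complex_def)
  have h: "?h \<beta> \<le> ?h \<alpha> \<longleftrightarrow> f \<beta> \<le> f \<alpha>" if "\<alpha> \<in> K" "\<beta> \<in> K" "immediate_face \<alpha> \<beta>" for \<alpha> \<beta>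
    using normalization_equivalent[OF fin f] that unfolding nat_equivalents_iff by blast
  have \<sigma>\<tau>: "\<sigma> \<in> K" "\<tau> \<in> K" "immediate_face \<sigma> \<tau>" "f \<tau> \<le> f \<sigma>" using less.prems by (auto simp: gradient_field_def)
  have ge: "?h \<tau> \<le> ?h \<sigma>" using h \<sigma>\<tau> by blast
  have "?h \<sigma> \<le> ?h \<tau>"
  proof (rule normalization_le_if_lowerable[OF fin f ge])
    show "?h \<beta> \<le> ?h \<tau>" if "\<beta> \<in> K" "immediate_face \<sigma> \<beta>" "f \<beta> \<le> f \<sigma>" for \<beta>
      using morse_function_unique_up[OF fin f less.prems, of \<beta>] that \<sigma>\<tau>(1) by (auto simp: gradient_field_def)
    show "f \<nu> < f \<sigma> \<and> ?h \<nu> < ?h \<tau>" if \<nu>: "\<nu> \<in> K" "immediate_face \<nu> \<sigma>" for \<nu>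
    proof
      have "(\<nu>, \<sigma>) \<notin> gradient_field K f" using morse_function_not_both[OF K f] less.prems by blast
      then show "f \<nu> < f \<sigma>" using \<nu> \<sigma>\<tau> by (auto simp: gradient_field_def)
      obtain \<sigma>' where \<sigma>': "\<sigma>' \<in> K" "\<sigma>' \<noteq> \<sigma>" "immediate_face \<nu> \<sigma>'" "immediate_face \<sigma>' \<tau>"
        using intermediate_face[OF K \<sigma>\<tau>(2) \<nu>(1) \<nu>(2) \<sigma>\<tau>(3)] .
      have "(\<sigma>', \<tau>) \<notin> gradient_field K f"
        using morse_function_unique_down[OF fin f less.prems, of \<sigma>'] \<sigma>' by blast
      then have "?h \<sigma>' < ?h \<tau>" using h[of \<sigma>' \<tau>] \<sigma>' \<sigma>\<tau> by (auto simp: gradient_field_def)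
      moreover have "?h \<nu> \<le> ?h \<sigma>'"
      proof (cases "(\<nu>, \<sigma>') \<in> gradient_field K f")
        case True
        then show ?thesis using less.hyps[of \<nu> \<sigma>'] \<nu>(2) by (auto simp: immediate_face_def)
      next
        case False
        then show ?thesis using h[of \<nu> \<sigma>'] \<sigma>' \<nu> by (auto simp: gradient_field_def)
      qed
      ultimately show "?h \<nu> < ?h \<tau>" by simp
    qed
  qed
  then show ?case using ge by simp
qed

lemma graded_matching_normalization:
  assumes K: "finite_simplicial_complex K" and dim: "\<And>\<sigma>. \<sigma> \<in> K \<Longrightarrow> card \<sigma> \<le> 3" and f: "morse_function K f"
  shows "graded_matching K (gradient_field K f) (normalization K f)"
proof
  have fin: "finite K" using K by (simp add: finite_simplicial_complex_def)
  show "finite_simplicial_complex K" by (rule K)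
  show "card \<sigma> \<le> 3" if "\<sigma> \<in> K" for \<sigma> using dim that .
  show "\<sigma> \<in> K \<and> \<tau> \<in> K \<and> immediate_face \<sigma> \<tau>" if "(\<sigma>, \<tau>) \<in> gradient_field K f" for \<sigma> \<tau>
    using that by (simp add: gradient_field_def)
  show "\<tau> = \<tau>'" if "(\<sigma>, \<tau>) \<in> gradient_field K f" "(\<sigma>, \<tau>') \<in> gradient_field K f" for \<sigma> \<tau> \<tau>'
    using morse_function_unique_up[OF fin f that] .
  show "\<sigma> = \<sigma>'" if "(\<sigma>, \<tau>) \<in> gradient_field K f" "(\<sigma>', \<tau>) \<in> gradient_field K f" for \<sigma> \<sigma>' \<tau>
    using morse_function_unique_down[OF fin f that] .
  show "(\<sigma>, \<tau>) \<notin> gradient_field K f" if "(\<rho>, \<sigma>) \<in> gradient_field K f" for \<rho> \<sigma> \<tau>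
    using morse_function_not_both[OF K f that] .
  show "normalization K f \<sigma> = normalization K f \<tau>" if "(\<sigma>, \<tau>) \<in> gradient_field K f" for \<sigma> \<tau>
    using normalization_matched[OF K dim f that] .
  show "normalization K f \<sigma> < normalization K f \<tau>"
    if "\<sigma> \<in> K" "\<tau> \<in> K" "immediate_face \<sigma> \<tau>" "(\<sigma>, \<tau>) \<notin> gradient_field K f" for \<sigma> \<tau>
  proof -
    have "normalization K f \<tau> \<le> normalization K f \<sigma> \<longleftrightarrow> f \<tau> \<le> f \<sigma>"
      using normalization_equivalent[OF fin f] that unfolding nat_equivalents_iff by blast
    then show ?thesis using that by (auto simp: gradient_field_def)
  qed
qed

section \<open>Collapses and the vanishing of the Morse number\<close>

lemma morse_function_of_collapse:
  assumes "elementary_collapse\<^sup>*\<^sup>* K {{v}}"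
  shows "finite K \<and> (\<exists>f. morse_function K f \<and> critical_simplices K f \<subseteq> {{v}})"
  using assms
proof (induction rule: converse_rtranclp_induct)
  case base
  have "morse_function {{v}} (\<lambda>_. 0)"
    by (rule morse_functionI[where W = "{}"]) (auto simp: immediate_face_def)
  moreover have "critical_simplices {{v}} (\<lambda>_. 0) \<subseteq> {{v}}" by (auto simp: critical_simplices_def)
  ultimately show ?case by blast
next
  case (step K L)
  obtain \<sigma> \<tau> where \<sigma>\<tau>: "\<sigma> \<in> K" "\<tau> \<in> K" "immediate_face \<sigma> \<tau>" "\<And>\<rho>. \<rho> \<in> K \<Longrightarrow> \<sigma> \<subset> \<rho> \<Longrightarrow> \<rho> = \<tau>"
    and L: "L = K - {\<sigma>, \<tau>}"
    using step.hyps(1) unfolding elementary_collapse_def by blast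
  obtain f where f: "morse_function L f" "critical_simplices L f \<subseteq> {{v}}" and finL: "finite L"
    using step.IH by blast
  have finK: "finite K" using finL L by simp
  have sub: "\<sigma> \<subset> \<tau>" using \<sigma>\<tau>(3) by (auto simp: immediate_face_def)
  \<comment> \<open>A level above all values on \<open>L\<close>, given to both simplices of the
    restored pair. The inserted 0 keeps \<open>Max\<close> defined even for empty
    \<open>L\<close>.\<close>
  define M where "M = Max (insert 0 (f ` L)) + 1"
  have M: "f \<rho> < M" if "\<rho> \<in> L" for \<rho>
  proof -
    have "f \<rho> \<le> Max (insert 0 (f ` L))" using finL that by (intro Max_ge) auto
    then show ?thesis by (simp add: M_def)
  qed
  define f' where "f' \<rho> = (if \<rho> \<in> L then f \<rho> else M)" for \<rho>
  \<comment> \<open>Only \<open>\<tau>\<close> lies properly over \<open>\<sigma>\<close>, so a new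
    incidence either joins the two or runs strictly upwards from \<open>L\<close> to the value
    \<open>M\<close>.\<close>
  have gradient: "gradient_field K f' = insert (\<sigma>, \<tau>) (gradient_field L f)"
  proof (intro subset_antisym subrelI)
    fix \<alpha> \<beta> assume "(\<alpha>, \<beta>) \<in> gradient_field K f'"
    then have \<alpha>\<beta>: "\<alpha> \<in> K" "\<beta> \<in> K" "immediate_face \<alpha> \<beta>" "f' \<beta> \<le> f' \<alpha>" by (auto simp: gradient_field_def)
    then have less: "\<alpha> \<subset> \<beta>" by (auto simp: immediate_face_def)
    show "(\<alpha>, \<beta>) \<in> insert (\<sigma>, \<tau>) (gradient_field L f)"
    proof (cases "\<alpha> \<in> L")
      case True
      then have "\<beta> \<in> L" using \<alpha>\<beta>(4) M[of \<alpha>] by (auto simp: f'_def split: if_splits)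
      then show ?thesis using True \<alpha>\<beta> by (simp add: gradient_field_def f'_def)
    next
      case False
      then have "\<alpha> = \<sigma> \<or> \<alpha> = \<tau>" using \<alpha>\<beta> L by blast
      then have "\<sigma> \<subset> \<beta>" using less sub by blast
      then have "\<beta> = \<tau>" using \<sigma>\<tau>(4) \<alpha>\<beta> by blast
      then show ?thesis using \<open>\<alpha> = \<sigma> \<or> \<alpha> = \<tau>\<close> less by blast
    qed
  next
    fix \<alpha> \<beta> assume "(\<alpha>, \<beta>) \<in> insert (\<sigma>, \<tau>) (gradient_field L f)"
    then show "(\<alpha>, \<beta>) \<in> gradient_field K f'"
      using \<sigma>\<tau> L by (auto simp: gradient_field_def f'_def)
  qed
  have in_L: "\<alpha> \<in> L \<and> \<beta> \<in> L" if "(\<alpha>, \<beta>) \<in> gradient_field L f" for \<alpha> \<beta>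
    using that by (simp add: gradient_field_def)
  have "morse_function K f'"
  proof (rule morse_functionI[where W = "gradient_field K f'"])
    show "(\<alpha>, \<beta>) \<in> gradient_field K f'" if "\<alpha> \<in> K" "\<beta> \<in> K" "immediate_face \<alpha> \<beta>" "f' \<beta> \<le> f' \<alpha>" for \<alpha> \<beta>
      using that by (simp add: gradient_field_def)
    show "\<beta> = \<beta>'" if "(\<alpha>, \<beta>) \<in> gradient_field K f'" "(\<alpha>, \<beta>') \<in> gradient_field K f'" for \<alpha> \<beta> \<beta>'
      using that morse_function_unique_up[OF finL f(1), of \<alpha> \<beta> \<beta>'] in_L[of \<alpha> \<beta>] in_L[of \<alpha> \<beta>'] L
      unfolding gradient by auto
    show "\<alpha> = \<alpha>'" if "(\<alpha>, \<beta>) \<in> gradient_field K f'" "(\<alpha>', \<beta>) \<in> gradient_field K f'" for \<alpha> \<alpha>' \<beta>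
      using that morse_function_unique_down[OF finL f(1), of \<alpha> \<beta> \<alpha>'] in_L[of \<alpha> \<beta>] in_L[of \<alpha>' \<beta>] L
      unfolding gradient by auto
  qed
  moreover have "critical_simplices K f' \<subseteq> critical_simplices L f"
    unfolding critical_simplices_eq[OF finK] critical_simplices_eq[OF finL] gradient using L by blast
  ultimately show ?case using f(2) finK by blast
qed

theorem theorem5:
  fixes K :: "'a set set"
  assumes "finite_simplicial_complex K"
    and "acyclic_complex K"
    and "has_dimension K 2"
  shows "collapsible K \<longleftrightarrow> min_morse_number K = 0"
proof -
  have fin: "finite K" using assms(1) by (simp add: finite_simplicial_complex_def)
  have dim: "card \<sigma> \<le> 3" if "\<sigma> \<in> K" for \<sigma>
    using assms(3) that unfolding has_dimension_def simplex_dim_def by fastforce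
  have "K \<noteq> {}" using assms(3) by (auto simp: has_dimension_def)
  have matching: "graded_matching K (gradient_field K f) (normalization K f)" if "morse_function K f" for f
    using graded_matching_normalization[OF assms(1) dim that] .
  have crit_sub: "graded_matching.crit K (gradient_field K f) n = {\<sigma> \<in> critical_simplices K f. card \<sigma> = n}"
    if "morse_function K f" for f n
    unfolding graded_matching.crit_def[OF matching[OF that]] critical_simplices_eq[OF fin] by auto
  \<comment> \<open>Critical vertices are normalized to 0, so only critical edges and triangles
    contribute.\<close>
  have morse_sum: "morse_number K f =
      int (\<Sum>\<sigma>\<in>graded_matching.crit K (gradient_field K f) 3. normalization K f \<sigma>) -
      int (\<Sum>\<sigma>\<in>graded_matching.crit K (gradient_field K f) 2. normalization K f \<sigma>)"
    if "morse_function K f" for f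
  proof -
    have "(\<Sum>\<sigma>\<in>graded_matching.crit K (gradient_field K f) 1. normalization K f \<sigma>) = 0"
      using normalization_critical_vertex[OF assms(1) that] crit_sub[OF that] by (intro sum.neutral) auto
    then show ?thesis
      unfolding morse_number_def graded_matching.alternating_sum_critical[OF matching[OF that]] by simp
  qed
  \<comment> \<open>There is always a critical vertex; hence a Morse function with at most one
    critical simplex, as a collapse yields, is optimal.\<close>
  have critical_ge: "card (critical_simplices K g) \<ge> 1" if "morse_function K g" for g
  proof -
    have "critical_simplices K g \<noteq> {}"
      using graded_matching.critical_vertex_exists[OF matching[OF that] \<open>K \<noteq> {}\<close>] crit_sub[OF that] by auto
    moreover have "finite (critical_simplices K g)" using fin by (simp add: critical_simplices_def)
    ultimately show ?thesis by (simp add: Suc_le_eq card_gt_0_iff)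
  qed
  show ?thesis
  proof
    assume "collapsible K"
    then obtain v where "elementary_collapse\<^sup>*\<^sup>* K {{v}}" unfolding collapsible_def by blast
    from morse_function_of_collapse[OF this] obtain f
      where f: "morse_function K f" "critical_simplices K f \<subseteq> {{v}}" by blast
    have "card (critical_simplices K f) \<le> 1"
      using card_mono[OF _ f(2)] by simp
    then have "optimal_morse_function K f"
      unfolding optimal_morse_function_def using f(1) critical_ge order.trans by blast
    moreover have "graded_matching.crit K (gradient_field K f) n = {}" if "n \<noteq> 1" for n
      using f(2) that unfolding crit_sub[OF f(1)] by auto
    then have "morse_number K f = 0" unfolding morse_sum[OF f(1)] by simp
    ultimately have "min_morse_number K \<le> 0"
      unfolding min_morse_number_def by (intro Least_le exI[of _ f]) simp
    then show "min_morse_number K = 0" by simp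
  next
    assume zero: "min_morse_number K = 0"
    \<comment> \<open>Some Morse function exists, here one with every simplex critical; so there is
      an optimal one and the \<open>LEAST\<close> in \<open>min_morse_number\<close> is
      attained.\<close>
    have "morse_function K (\<lambda>\<sigma>. real (card \<sigma>))"
      by (rule morse_functionI[where W = "{}"]) (auto simp: immediate_face_def)
    then obtain f\<^sub>0 where "morse_function K f\<^sub>0"
      "\<And>g. morse_function K g \<Longrightarrow> card (critical_simplices K f\<^sub>0) \<le> card (critical_simplices K g)"
      using ex_has_least_nat[of "morse_function K" _ "\<lambda>f. card (critical_simplices K f)"] by blast
    then have "\<exists>n f. optimal_morse_function K f \<and> n = nat \<bar>morse_number K f\<bar>"
      unfolding optimal_morse_function_def by blast
    then have "\<exists>f. optimal_morse_function K f \<and> min_morse_number K = nat \<bar>morse_number K f\<bar>"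
      unfolding min_morse_number_def by (rule LeastI_ex)
    then obtain f where opt: "optimal_morse_function K f" and sum_0: "morse_number K f = 0"
      using zero by auto
    then have f: "morse_function K f" by (simp add: optimal_morse_function_def)
    let ?V = "gradient_field K f"
    let ?h = "normalization K f"
    interpret graded_matching K ?V ?h by (rule matching[OF f])
    have critical: "critical_simplices K f = crit 1 \<union> crit 2 \<union> crit 3"
      using card_cases unfolding crit_sub[OF f] by (auto simp: critical_simplices_def)
    have "crit 1 \<noteq> {}" by (rule critical_vertex_exists[OF \<open>K \<noteq> {}\<close>])
    then obtain \<sigma> where \<sigma>: "\<sigma> \<in> crit 1" by blast
    then obtain r where r: "\<sigma> = {r}" by (auto simp: crit_def card_1_singleton_iff)
    then have rK: "{r} \<in> K" using \<sigma> by (simp add: crit_def)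
    \<comment> \<open>Comparing the optimal \<open>f\<close> with this competitor gives
      \<open>2 * card (crit 1) \<le> 2\<close>.\<close>
    obtain g where g: "morse_function K g"
      "card (critical_simplices K g) + card (crit 1) \<le> card (crit 2) + card (crit 3) + 2"
      using morse_function_from_spanning_tree[OF assms(2) rK] by blast
    have "crit 1 \<inter> crit 2 = {}" "(crit 1 \<union> crit 2) \<inter> crit 3 = {}" by (auto simp: crit_def)
    then have "card (critical_simplices K f) = card (crit 1) + card (crit 2) + card (crit 3)"
      unfolding critical by (simp add: card_Un_disjoint finite_crit)
    moreover have "card (critical_simplices K f) \<le> card (critical_simplices K g)"
      using opt g(1) by (simp add: optimal_morse_function_def)
    ultimately have "card (crit 1) \<le> 1" using g(2) by linarith
    then have root: "crit 1 = {{r}}"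
      using \<sigma> r finite_crit[of 1] card_le_Suc0_iff_eq[of "crit 1"] by auto
    have "(\<Sum>e\<in>crit 2. ?h e) + card (crit 2) \<le> (\<Sum>t\<in>crit 3. ?h t)"
      using sum_gap_of_level_counts[OF finite_crit finite_crit card_critical_edges_le[OF assms(2) root]]
        card_critical_triangles_le[OF assms(2)] by blast
    \<comment> \<open>As the Morse number vanishes, the two sums agree, which forces the gap
      \<open>card (crit 2)\<close> to be zero.\<close>
    moreover have "(\<Sum>t\<in>crit 3. ?h t) = (\<Sum>e\<in>crit 2. ?h e)"
      using sum_0 morse_sum[OF f] by linarith
    ultimately have "card (crit 2) = 0" by linarith
    then have no_edges: "crit 2 = {}" using finite_crit by simp
    \<comment> \<open>Without critical edges, the level bound at the level of a critical triangle
      excludes that triangle itself.\<close>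
    have no_triangles: "crit 3 = {}"
    proof (rule ccontr)
      assume "crit 3 \<noteq> {}"
      then obtain t where "t \<in> crit 3" by blast
      then have "card {t' \<in> crit 3. ?h t' \<le> ?h t} > 0" using finite_crit by (auto simp: card_gt_0_iff)
      then show False using card_critical_triangles_le[OF assms(2), of "?h t"] no_edges by simp
    qed
    have "elementary_collapse\<^sup>*\<^sup>* K {{r}}"
    proof (rule collapsible_if_matched[OF graded_matching_axioms rK])
      show "\<sigma> \<in> Domain ?V \<or> \<sigma> \<in> Range ?V \<or> \<sigma> = {r}" if "\<sigma> \<in> K" for \<sigma>
      proof (rule ccontr)
        assume neg: "\<not> ?thesis"
        then have "\<sigma> \<in> crit 1 \<union> crit 2 \<union> crit 3" using that card_cases[OF that] by (auto simp: crit_def)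
        then show False using neg root no_edges no_triangles by auto
      qed
      show "{r} \<notin> Domain ?V" using root by (auto simp: crit_def)
    qed
    then show "collapsible K" unfolding collapsible_def by blast
  qed
qed

end
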